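(* Let $(a_n)_{n\in\mathbb{Z}}$ be independent identically distributed real Gaussian random variables with mean $0$ and variance $1$, and let $f$ be the random entire function given by the almost surely convergent series $$f(z)=\sum_{n\in\mathbb{Z}} a_n\,\frac{\sin \pi(z-n)}{\pi(z-n)},\qquad z\in\mathbb{C}.$$ Let $Z(f)$ denote the zero set of $f$. Then there exist constants $c,C>0$ such that for all real $r\ge 1$, $$e^{-cr}\le \mathbb{P}\big(\#(Z(f)\cap(-r,r))=0\big)\le e^{-Cr}.$$
   Context: For $n\in\mathbb{Z}$, the function $z\mapsto \frac{\sin\pi(z-n)}{\pi(z-n)}$ is understood to take the value $1$ at $z=n$, so it is entire. Since $\sum_{n\in\mathbb{Z}}\left|\frac{\sin\pi(z-n)}{\pi(z-n)}\right|^2$ converges uniformly on compact subsets of $\mathbb{C}$, the series defining $f$ almost surely defines an entire function. $Z(f)=\{z\in\mathbb{C}: f(z)=0\}$, and $(-r,r)$ is the open interval of the real line, so the event in question is that $f$ has no zero in $(-r,r)$. The constants $c,C$ do not depend on $r$. *)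

theory Defs
  imports "HOL-Probability.Probability"
begin

(* The library's sinc (HOL-Probability.Sinc_Integral) is real-valued on the reals only. *)
definition csinc :: "complex \<Rightarrow> complex" where
  "csinc z = (if z = 0 then 1 else sin z / z)"

(* With Gaussian coefficients the series converges almost surely, but not absolutely, so infsum
   (unordered summation) is not applicable. A series over the integers is read as the sum of its
   two one-sided series. Where one of these diverges (a null event) the value is arbitrary. *)
definition sinc_series :: "(int \<Rightarrow> real) \<Rightarrow> complex \<Rightarrow> complex" where
  "sinc_series a z =
     (\<Sum>k. of_real (a (int k)) * csinc (of_real pi * (z - of_int (int k)))) +
     (\<Sum>k. of_real (a (- int (Suc k))) * csinc (of_real pi * (z - of_int (- int (Suc k)))))"

definition zero_set :: "(complex \<Rightarrow> complex) \<Rightarrow> complex set" where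
  "zero_set f = {z. f z = 0}"

(* The real interval (-r,r) as a subset of the complex plane. Having cardinality 0 is expressed
   as emptiness, because card is 0 on infinite sets as well. *)
definition hole_event :: "'a measure \<Rightarrow> (int \<Rightarrow> 'a \<Rightarrow> real) \<Rightarrow> real \<Rightarrow> 'a set" where
  "hole_event M a r =
     {\<omega> \<in> space M. zero_set (sinc_series (\<lambda>n. a n \<omega>)) \<inter> of_real ` {-r<..<r} = {}}"

(* The series defines an entire function only outside a null event, on which the hole event need
   not be measurable; hence the probability is taken in the completion of M, which agrees with M
   on the sets of M. *)
definition hole_prob :: "'a measure \<Rightarrow> (int \<Rightarrow> 'a \<Rightarrow> real) \<Rightarrow> real \<Rightarrow> real" where
  "hole_prob M a r = measure (completion M) (hole_event M a r)"

end

(* Upper bound: f(n) = a_n, and f is a.s. continuous on the line, so absence of zeros in (-r,r) forces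
   all a_n with |n| <= r to have the same weak sign.

   Lower bound: on the line (-1)^n sin(pi (x-n)) does not depend on n, so by Abel summation f is
   controlled by the alternating partial sums S_i of the coefficients. Let the a_n with -K <= n < K,
   where K is a large multiple of r, be such that the alternating partial sums of a_n - 30 stay in
   [-1,1]. As a random walk confined to an interval this has probability at least p^(2K). The constant
   30 then contributes at least 10 to f(x) and the fluctuation at most 4. The remaining coefficients
   are independent of the walk and contribute at most 4 with probability at least 1/2, by first and
   second moment bounds. So f >= 2 on (-r,r) with probability at least p^(2K) / 2. *)
theory Submission
  imports Defs
begin

section \<open>The series on the real line\<close>

text \<open>Keeping each coefficient in a fixed window around a constant is not enough: the errors
  could add up like the sum of 1/|x - n|, that is like log r, and windows shrinking like 1/log r
  would put an extra factor log log r into the exponent. Confining the alternating partial sums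
  instead costs one constant factor per coefficient, while summation by parts bounds the error
  independently of r. The size 30 is a budget. To the left and to the right of x the constant meets
  an alternating sum of decreasing weights, which is at least the first weight minus the second;
  this gap is at least 1/3 on the side whose nearest integer is within 1/2 of x. The fluctuation
  costs at most 2 on each side and each of the two tails at most 2, so l/3 > 8 is what a constant l
  has to satisfy. K is proportional to r because the bound on a tail has a part independent of x,
  with second moment at most 1/K, and a part growing with x, with mean of order r/K.\<close>

definition rsinc :: "real \<Rightarrow> real" where
  "rsinc t = (if t = 0 then 1 else sin t / t)"

lemma csinc_of_real: "csinc (of_real t) = of_real (rsinc t)"
  by (simp add: csinc_def rsinc_def flip: sin_of_real)

lemma rsinc_minus [simp]: "rsinc (- t) = rsinc t"
  by (simp add: rsinc_def)

lemma abs_mult_rsinc_le: "\<bar>t * rsinc t\<bar> \<le> 1"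
  by (simp add: rsinc_def)

lemma abs_rsinc_le: "\<bar>rsinc t\<bar> \<le> 1"
  using abs_sin_x_le_abs_x[of t] by (simp add: rsinc_def divide_simps)

lemma continuous_on_rsinc: "continuous_on A rsinc"
proof -
  have "rsinc = (\<lambda>x. if x = 0 then 1 else sin x / x)"
    by (simp add: rsinc_def fun_eq_iff)
  then show ?thesis
    using continuous_on_sinc[of A "\<lambda>x. x"] continuous_on_id by metis
qed

lemma rsinc_pi_int: "rsinc (pi * of_int n) = (if n = 0 then 1 else 0)"
  using sin_times_pi_eq_0[of "of_int n"] by (auto simp: rsinc_def mult.commute[of pi])

lemma sin_pi_minus_nat: "sin (pi * (x - real k)) = (- 1) ^ k * sin (pi * x)"
  using sin_diff[of "pi * x" "pi * real k"] by (simp add: right_diff_distrib mult.commute[of pi "real k"])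

text \<open>From \<open>1 / (x - k) = - 1 / (k + 1) + (x + 1) / ((k + 1) (x - k))\<close>: the slowly decaying part of
  the kernel factors through the alternating series, which does not depend on \<open>x\<close>.\<close>

lemma rsinc_shift:
  "rsinc (pi * (x - real k)) =
     - (sin (pi * x) / pi) * ((- 1) ^ k / (real k + 1)) +
     (x + 1) * (rsinc (pi * (x - real k)) / (real k + 1))"
proof (cases "x = real k")
  case True
  have "sin (pi * real k) = 0" by simp
  with True show ?thesis by (simp add: rsinc_def)
next
  case False
  have s: "rsinc (pi * (x - real k)) = ((- 1) ^ k * sin (pi * x) / pi) / (x - real k)"
    using False unfolding rsinc_def sin_pi_minus_nat by simp
  have eq: "A / (x - real k) = - A / (real k + 1) + (x + 1) * (A / (x - real k) / (real k + 1))" for A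
    using False by (simp add: divide_simps) (simp add: algebra_simps)
  have "- (sin (pi * x) / pi) * ((- 1) ^ k / (real k + 1)) =
      - ((- 1) ^ k * sin (pi * x) / pi) / (real k + 1)"
    by simp
  note h = this
  show ?thesis
    unfolding s h by (rule eq)
qed

text \<open>Writing k + 1 = (x + 1) - (x - k) avoids distinguishing whether k is near x. With this
  decay the remainder in \<open>rsinc_shift\<close> is of order 1/(k + 1)^2, locally uniformly in
  x.\<close>

lemma abs_rsinc_le_inverse: "\<bar>(real k + 1) * rsinc (pi * (x - real k))\<bar> \<le> \<bar>x + 1\<bar> + 1"
proof -
  define s where "s = rsinc (pi * (x - real k))"
  have "(real k + 1) * s = (x + 1) * s - (x - real k) * s"
    by (simp add: algebra_simps)
  then have A: "\<bar>(real k + 1) * s\<bar> \<le> \<bar>(x + 1) * s\<bar> + \<bar>(x - real k) * s\<bar>"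
    by (simp only: abs_triangle_ineq4)
  have B: "\<bar>(x + 1) * s\<bar> \<le> \<bar>x + 1\<bar> * 1"
    unfolding abs_mult s_def by (intro mult_left_mono abs_rsinc_le) auto
  have "\<bar>pi * ((x - real k) * s)\<bar> \<le> 1"
    using abs_mult_rsinc_le[of "pi * (x - real k)"] by (simp add: s_def mult.assoc)
  moreover have "1 * \<bar>(x - real k) * s\<bar> \<le> pi * \<bar>(x - real k) * s\<bar>"
    using pi_ge_two by (intro mult_right_mono) auto
  ultimately have "\<bar>(x - real k) * s\<bar> \<le> 1"
    by (simp add: abs_mult)
  from order_trans[OF A add_mono[OF B this]] show ?thesis
    by (simp add: s_def)
qed

lemma rsinc_term_shift:
  "d k * rsinc (pi * (x - real k)) =
     - (sin (pi * x) / pi) * ((- 1) ^ k * d k / (real k + 1)) +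
     (x + 1) * (d k * rsinc (pi * (x - real k)) / (real k + 1))"
  by (subst rsinc_shift) (simp add: algebra_simps)

lemma rsinc_term_bound:
  "\<bar>d k * rsinc (pi * (x - real k)) / (real k + 1)\<bar>
     \<le> (\<bar>x + 1\<bar> + 1) * (\<bar>d k\<bar> / (real k + 1)\<^sup>2)"
proof -
  have "\<bar>rsinc (pi * (x - real k))\<bar> \<le> (\<bar>x + 1\<bar> + 1) / (real k + 1)"
    using abs_rsinc_le_inverse[of k x] by (simp add: abs_mult pos_le_divide_eq mult.commute)
  then have "\<bar>d k\<bar> * \<bar>rsinc (pi * (x - real k))\<bar> / (real k + 1)
      \<le> \<bar>d k\<bar> * ((\<bar>x + 1\<bar> + 1) / (real k + 1)) / (real k + 1)"
    by (intro divide_right_mono mult_left_mono) auto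
  then show ?thesis by (simp add: abs_mult power2_eq_square mult.commute)
qed

text \<open>The two conditions match the two parts of \<open>rsinc_shift\<close>: absolute
  convergence of the remainder, conditional convergence of the alternating series. Neither mentions
  x, so one null event serves all points of the line.\<close>

definition admissible :: "(nat \<Rightarrow> real) \<Rightarrow> bool" where
  "admissible d \<longleftrightarrow> summable (\<lambda>k. \<bar>d k\<bar> / (real k + 1)\<^sup>2) \<and>
     summable (\<lambda>k. (- 1) ^ k * d k / (real k + 1))"

definition half_series :: "(nat \<Rightarrow> real) \<Rightarrow> real \<Rightarrow> real" where
  "half_series d x = (\<Sum>k. d k * rsinc (pi * (x - real k)))"

lemma summable_remainder:
  assumes "admissible d"
  shows "summable (\<lambda>k. d k * rsinc (pi * (x - real k)) / (real k + 1))"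
proof (rule summable_comparison_test)
  show "summable (\<lambda>k. (\<bar>x + 1\<bar> + 1) * (\<bar>d k\<bar> / (real k + 1)\<^sup>2))"
    using assms by (intro summable_mult) (simp add: admissible_def)
qed (use rsinc_term_bound in auto)

lemma half_sums:
  assumes "admissible d"
  shows "(\<lambda>k. d k * rsinc (pi * (x - real k))) sums
     (- (sin (pi * x) / pi) * (\<Sum>k. (- 1) ^ k * d k / (real k + 1)) +
      (x + 1) * (\<Sum>k. d k * rsinc (pi * (x - real k)) / (real k + 1)))"
  using assms summable_remainder[OF assms]
  by (intro sums_cong[THEN iffD2, OF rsinc_term_shift] sums_add sums_mult summable_sums)
    (auto simp: admissible_def)

text \<open>The Weierstrass test would fail on the series itself, whose convergence is only
  conditional. After the decomposition of \<open>half_sums\<close> it is applied to the remainder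
  alone; the other part is a constant times a sine.\<close>

lemma continuous_on_half_series:
  assumes "admissible d"
  shows "continuous_on UNIV (half_series d)"
proof -
  let ?g = "\<lambda>x. \<Sum>k. d k * rsinc (pi * (x - real k)) / (real k + 1)"
  have cont: "continuous_on {-R..R} ?g" for R
  proof (rule uniform_limit_theorem)
    show "uniform_limit {-R..R} (\<lambda>n x. \<Sum>k<n. d k * rsinc (pi * (x - real k)) / (real k + 1)) ?g
        sequentially"
    proof (rule Weierstrass_m_test)
      show "summable (\<lambda>k. (R + 2) * (\<bar>d k\<bar> / (real k + 1)\<^sup>2))"
        using assms by (intro summable_mult) (simp add: admissible_def)
      fix k x assume "x \<in> {-R..R}"
      then have "(\<bar>x + 1\<bar> + 1) * (\<bar>d k\<bar> / (real k + 1)\<^sup>2) \<le> (R + 2) * (\<bar>d k\<bar> / (real k + 1)\<^sup>2)"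
        by (intro mult_right_mono) auto
      with rsinc_term_bound[of d k x]
      show "norm (d k * rsinc (pi * (x - real k)) / (real k + 1)) \<le> (R + 2) * (\<bar>d k\<bar> / (real k + 1)\<^sup>2)"
        by simp
    qed
    show "\<forall>\<^sub>F n in sequentially. continuous_on {-R..R}
        (\<lambda>x. \<Sum>k<n. d k * rsinc (pi * (x - real k)) / (real k + 1))"
      by (intro always_eventually allI continuous_intros
          continuous_on_compose2[OF continuous_on_rsinc[of UNIV]]) auto
  qed auto
  have "isCont ?g x" for x
  proof (rule continuous_on_interior[OF cont[of "\<bar>x\<bar> + 1"]])
    show "x \<in> interior {- (\<bar>x\<bar> + 1)..\<bar>x\<bar> + 1}" by (simp; linarith)
  qed
  then have "continuous_on UNIV ?g"
    by (simp add: continuous_on_eq_continuous_at)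
  moreover have "half_series d = (\<lambda>x. - (sin (pi * x) / pi) * (\<Sum>k. (- 1) ^ k * d k / (real k + 1)) +
      (x + 1) * ?g x)"
    unfolding half_series_def using half_sums[OF assms] by (auto simp: fun_eq_iff sums_iff)
  ultimately show ?thesis
    by (auto intro!: continuous_intros)
qed

section \<open>Tails of the one-sided series\<close>

definition signed_tail :: "nat \<Rightarrow> (nat \<Rightarrow> real) \<Rightarrow> real" where
  "signed_tail K d = (\<Sum>k. (- 1) ^ (k + K) * d (k + K) / (real (k + K) + 1))"

definition abs_tail :: "nat \<Rightarrow> (nat \<Rightarrow> real) \<Rightarrow> real" where
  "abs_tail K d = (\<Sum>k. \<bar>d (k + K)\<bar> / (real (k + K) + 1)\<^sup>2)"

lemma summable_shifts:
  assumes "admissible d"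
  shows "summable (\<lambda>k. (- 1) ^ (k + K) * d (k + K) / (real (k + K) + 1))"
    and "summable (\<lambda>k. \<bar>d (k + K)\<bar> / (real (k + K) + 1)\<^sup>2)"
  using assms summable_iff_shift[of "\<lambda>k. (- 1) ^ k * d k / (real k + 1)" K]
    summable_iff_shift[of "\<lambda>k. \<bar>d k\<bar> / (real k + 1)\<^sup>2" K]
  by (simp_all add: admissible_def)

lemma abs_tail_nonneg: "admissible d \<Longrightarrow> 0 \<le> abs_tail K d"
  unfolding abs_tail_def by (intro suminf_nonneg summable_shifts) auto

text \<open>The two tail functionals do not depend on x, so a supremum over x is controlled by
  moments of two random variables. Beyond K the hypothesis gives |x - n| \<ge> (n + 1)/2, and the
  factor 2 is absorbed by pi \<ge> 2.\<close>

lemma half_tail_bound: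
  assumes "admissible d" and K: "2 * \<bar>x + 1\<bar> \<le> real K"
  shows "\<bar>\<Sum>k. d (k + K) * rsinc (pi * (x - real (k + K)))\<bar> \<le>
     \<bar>signed_tail K d\<bar> + \<bar>x + 1\<bar> * abs_tail K d"
proof -
  let ?A = "\<Sum>k. (- 1) ^ (k + K) * d (k + K) / (real (k + K) + 1)"
  let ?r = "\<lambda>k. d (k + K) * rsinc (pi * (x - real (k + K))) / (real (k + K) + 1)"
  note sA = summable_shifts(1)[OF assms(1), of K] and sB = summable_shifts(2)[OF assms(1), of K]
  have le: "\<bar>?r k\<bar> \<le> \<bar>d (k + K)\<bar> / (real (k + K) + 1)\<^sup>2" for k
  proof -
    let ?n = "real (k + K)"
    have "?n + 1 \<le> 2 * \<bar>x - ?n\<bar>" using K by (simp add: abs_if split: if_splits)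
    also have "\<dots> \<le> \<bar>pi * (x - ?n)\<bar>"
      unfolding abs_mult using pi_ge_two by (intro mult_right_mono) auto
    finally have "(?n + 1) * \<bar>rsinc (pi * (x - ?n))\<bar> \<le> \<bar>pi * (x - ?n)\<bar> * \<bar>rsinc (pi * (x - ?n))\<bar>"
      by (intro mult_right_mono) auto
    also have "\<dots> \<le> 1" using abs_mult_rsinc_le by (simp flip: abs_mult)
    finally have "\<bar>rsinc (pi * (x - ?n))\<bar> \<le> 1 / (?n + 1)"
      by (simp add: pos_le_divide_eq mult.commute)
    then have "\<bar>d (k + K)\<bar> * \<bar>rsinc (pi * (x - ?n))\<bar> / (?n + 1)
        \<le> \<bar>d (k + K)\<bar> * (1 / (?n + 1)) / (?n + 1)"
      by (intro divide_right_mono mult_left_mono) auto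
    then show ?thesis by (simp add: abs_mult power2_eq_square)
  qed
  have sabs: "summable (\<lambda>k. \<bar>?r k\<bar>)"
    using le by (intro summable_comparison_test[OF _ sB]) auto
  have sr: "summable ?r" by (rule summable_rabs_cancel[OF sabs])
  have eq: "(\<Sum>k. d (k + K) * rsinc (pi * (x - real (k + K)))) =
      - (sin (pi * x) / pi) * ?A + (x + 1) * (\<Sum>k. ?r k)"
    using sA sr
    by (intro sums_unique[symmetric] sums_cong[THEN iffD2, OF rsinc_term_shift] sums_add sums_mult
        summable_sums)
  have "\<bar>\<Sum>k. d (k + K) * rsinc (pi * (x - real (k + K)))\<bar> \<le>
      \<bar>- (sin (pi * x) / pi)\<bar> * \<bar>?A\<bar> + \<bar>x + 1\<bar> * \<bar>\<Sum>k. ?r k\<bar>"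
    unfolding abs_mult[symmetric] eq by (rule abs_triangle_ineq)
  also have "\<dots> \<le> 1 * \<bar>?A\<bar> + \<bar>x + 1\<bar> * (\<Sum>k. \<bar>d (k + K)\<bar> / (real (k + K) + 1)\<^sup>2)"
  proof (intro add_mono mult_right_mono mult_left_mono)
    show "\<bar>- (sin (pi * x) / pi)\<bar> \<le> 1"
    proof -
      have "\<bar>sin (pi * x)\<bar> \<le> pi"
        using pi_ge_two abs_sin_le_one[of "pi * x"] by linarith
      then show ?thesis by (simp add: pos_divide_le_eq)
    qed
    have "\<bar>\<Sum>k. ?r k\<bar> \<le> (\<Sum>k. \<bar>?r k\<bar>)" by (rule summable_rabs[OF sabs])
    also have "\<dots> \<le> (\<Sum>k. \<bar>d (k + K)\<bar> / (real (k + K) + 1)\<^sup>2)"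
      by (rule suminf_le[OF le sabs sB])
    finally show "\<bar>\<Sum>k. ?r k\<bar> \<le> \<dots>" .
  qed auto
  finally show ?thesis by (simp add: signed_tail_def abs_tail_def)
qed

section \<open>Alternating sums and the kernel as a decreasing weight\<close>

lemma alternating_sum_bounds:
  fixes t :: "nat \<Rightarrow> real"
  assumes "\<And>j. 0 \<le> t j" "\<And>j. t (Suc j) \<le> t j"
  shows "0 \<le> (\<Sum>j<n. (- 1) ^ j * t j) \<and> (\<Sum>j<n. (- 1) ^ j * t j) \<le> t 0"
  using assms
proof (induction n arbitrary: t)
  case (Suc n)
  have "0 \<le> (\<Sum>j<n. (- 1) ^ j * t (Suc j)) \<and> (\<Sum>j<n. (- 1) ^ j * t (Suc j)) \<le> t (Suc 0)"
    using Suc.IH[of "\<lambda>j. t (Suc j)"] Suc.prems by blast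
  moreover have "(\<Sum>j<Suc n. (- 1) ^ j * t j) = t 0 - (\<Sum>j<n. (- 1) ^ j * t (Suc j))"
    by (simp add: sum.lessThan_Suc_shift sum_negf del: sum.lessThan_Suc)
  ultimately show ?case using Suc.prems(2)[of 0] by auto
qed simp

lemma alternating_sum_lower:
  fixes t :: "nat \<Rightarrow> real"
  assumes "\<And>j. 0 \<le> t j" "\<And>j. t (Suc j) \<le> t j" "0 < n"
  shows "t 0 - t 1 \<le> (\<Sum>j<n. (- 1) ^ j * t j)"
proof -
  obtain m where m: "n = Suc m" using assms(3) gr0_implies_Suc by blast
  have "(\<Sum>j<m. (- 1) ^ j * t (Suc j)) \<le> t (Suc 0)"
    using alternating_sum_bounds[of "\<lambda>j. t (Suc j)" m] assms(1,2) by blast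
  then show ?thesis by (simp add: m sum.lessThan_Suc_shift sum_negf del: sum.lessThan_Suc)
qed

text \<open>Summation by parts: the weights \<open>t j - t (Suc j)\<close> for j < n together with
  \<open>t n\<close> are nonnegative and add up to \<open>t 0\<close>.\<close>

lemma abel_sum_bound:
  fixes t c :: "nat \<Rightarrow> real"
  assumes "\<And>j. 0 \<le> t j" "\<And>j. t (Suc j) \<le> t j"
    and B: "\<And>i. i \<le> n \<Longrightarrow> \<bar>\<Sum>j<i. c j\<bar> \<le> B"
  shows "\<bar>\<Sum>j<n. c j * t j\<bar> \<le> B * t 0"
proof -
  have eq: "(\<Sum>j<n. c j * t j) = (\<Sum>j<n. (\<Sum>i\<le>j. c i) * (t j - t (Suc j))) + (\<Sum>j<n. c j) * t n" for n
    by (induction n) (auto simp: algebra_simps simp flip: lessThan_Suc_atMost)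
  have "\<bar>\<Sum>j<n. c j * t j\<bar> \<le> \<bar>\<Sum>j<n. (\<Sum>i\<le>j. c i) * (t j - t (Suc j))\<bar> + \<bar>(\<Sum>j<n. c j) * t n\<bar>"
    unfolding eq by (rule abs_triangle_ineq)
  also have "\<dots> \<le> (\<Sum>j<n. \<bar>(\<Sum>i\<le>j. c i) * (t j - t (Suc j))\<bar>) + \<bar>(\<Sum>j<n. c j) * t n\<bar>"
    by (intro add_right_mono sum_abs)
  also have "\<dots> \<le> (\<Sum>j<n. B * (t j - t (Suc j))) + B * t n"
  proof (intro add_mono sum_mono)
    fix j assume "j \<in> {..<n}"
    then have "\<bar>\<Sum>i\<le>j. c i\<bar> \<le> B" using B[of "Suc j"] by (simp add: lessThan_Suc_atMost)
    then show "\<bar>(\<Sum>i\<le>j. c i) * (t j - t (Suc j))\<bar> \<le> B * (t j - t (Suc j))"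
      using assms(2)[of j] by (simp add: abs_mult mult_right_mono)
  next
    show "\<bar>(\<Sum>j<n. c j) * t n\<bar> \<le> B * t n"
      using assms(1)[of n] B[of n] by (simp add: abs_mult mult_right_mono)
  qed
  also have "(\<Sum>j<n. B * (t j - t (Suc j))) = B * (t 0 - t n)"
    by (simp add: sum_lessThan_telescope' flip: sum_distrib_left)
  finally show ?thesis by (simp add: algebra_simps)
qed

text \<open>Here v is the distance from a point to the first integer on one side, and j counts the
  integers outwards from there. The factor (-1)^j cancels the sign of the sine and leaves sin(pi v)
  / (pi (v + j)), nonnegative and decreasing in j.\<close>

definition altsinc :: "real \<Rightarrow> nat \<Rightarrow> real" where
  "altsinc v j = (- 1) ^ j * rsinc (pi * (v + real j))"

lemma sin_pi_plus_nat: "sin (pi * (x + real k)) = (- 1) ^ k * sin (pi * x)"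
  by (simp add: distrib_left sin_add)

lemma altsinc_eq:
  "0 < v \<Longrightarrow> altsinc v j = sin (pi * v) / (pi * (v + real j))"
  "altsinc 0 j = (if j = 0 then 1 else 0)"
  by (simp_all add: altsinc_def rsinc_def sin_pi_plus_nat)

lemma altsinc_mono:
  assumes "0 \<le> v" "v \<le> 1"
  shows "0 \<le> altsinc v j" "altsinc v (Suc j) \<le> altsinc v j" "altsinc v 0 \<le> 1"
proof -
  have s: "0 \<le> sin (pi * v)" using assms by (intro sin_ge_zero) auto
  show "0 \<le> altsinc v j"
    by (cases "v = 0") (use assms s in \<open>auto simp: altsinc_eq\<close>)
  show "altsinc v (Suc j) \<le> altsinc v j"
  proof (cases "v = 0")
    case False
    then show ?thesis using assms s
      by (simp add: altsinc_eq) (intro divide_left_mono mult_left_mono mult_pos_pos; simp)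
  qed (simp add: altsinc_eq)
  show "altsinc v 0 \<le> 1"
    using abs_rsinc_le[of "pi * v"] by (simp add: altsinc_def)
qed

text \<open>At the half angle z = y/2 the cosine is at least sqrt 2 / 2, and the mean value theorem
  gives sin z \<ge> z cos z. Hence sin y = 2 sin z cos z \<ge> 2 z (cos z)^2 \<ge> z.\<close>

lemma sin_ge_half:
  fixes y :: real
  assumes "0 \<le> y" "y \<le> pi / 2"
  shows "y / 2 \<le> sin y"
proof (cases "y = 0")
  case False
  define z where "z = y / 2"
  have z: "0 < z" "z \<le> pi / 4" using assms False by (auto simp: z_def)
  have "\<exists>w. 0 < w \<and> w < z \<and> sin z - sin 0 = (z - 0) * cos w"
    using z by (intro MVT2) (auto intro!: derivative_eq_intros)
  then obtain w where w: "0 < w" "w < z" "sin z = z * cos w" by auto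
  have c: "sqrt 2 / 2 \<le> cos z"
    using z pi_gt_zero cos_monotone_0_pi_le[of z "pi / 4"] by (simp add: cos_45)
  have "cos z \<le> cos w" using w z pi_gt_zero by (intro cos_monotone_0_pi_le) auto
  then have "z * cos z \<le> sin z" using w z by simp
  moreover have c0: "0 \<le> cos z" using c by (rule order_trans[rotated]) simp
  ultimately have "z * cos z * cos z \<le> sin z * cos z" by (intro mult_right_mono)
  moreover have "1 / 2 \<le> cos z * cos z"
    using mult_mono[OF c c] c0 by simp
  then have "z * (1 / 2) \<le> z * (cos z * cos z)"
    using z by (intro mult_left_mono) auto
  moreover have "sin y = 2 * (sin z * cos z)" using sin_double[of z] by (simp add: z_def)
  ultimately show ?thesis by (simp add: z_def)
qed simp

text \<open>The difference factors as sin(pi v)/(pi v) times 1/(v + 1), and the factors are at least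
  1/2 and 2/3. The restriction on v matters: at v = 1 the gap is 0.\<close>

lemma altsinc_gap:
  assumes "0 \<le> v" "v \<le> 1 / 2"
  shows "1 / 3 \<le> altsinc v 0 - altsinc v 1"
proof (cases "v = 0")
  case False
  with assms have v: "0 < v" by simp
  have "altsinc v 0 - altsinc v 1 = sin (pi * v) / (pi * v) * (1 / (v + 1))"
    using v by (simp add: altsinc_eq divide_simps) (simp add: algebra_simps)
  moreover have "1 / 2 \<le> sin (pi * v) / (pi * v)"
    using sin_ge_half[of "pi * v"] v assms by (simp add: pos_le_divide_eq)
  moreover have "2 / 3 \<le> 1 / (v + 1)" using v assms by (simp add: divide_simps)
  then have "1 / 2 * (2 / 3) \<le> sin (pi * v) / (pi * v) * (1 / (v + 1))"
    using \<open>1 / 2 \<le> sin (pi * v) / (pi * v)\<close> by (intro mult_mono; linarith)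
  ultimately show ?thesis by simp
qed (simp add: altsinc_eq)

text \<open>Split \<open>b j\<close> into \<open>l\<close> and \<open>b j - l\<close>. The kernel
  equals (-1)^j times the decreasing weight \<open>altsinc v j\<close>, so the constant part is an
  alternating sum, nonnegative in any case, and the rest falls under \<open>abel_sum_bound\<close>
  with first weight at most 1.\<close>

lemma half_bulk_lower:
  assumes v: "0 \<le> v" "v \<le> 1" and n: "0 < n" and l: "0 \<le> l"
    and B: "\<And>i. i \<le> n \<Longrightarrow> \<bar>\<Sum>j<i. (- 1) ^ j * (b j - l)\<bar> \<le> 2"
  shows "l * (if v \<le> 1 / 2 then 1 / 3 else 0) - 2 \<le> (\<Sum>j<n. b j * rsinc (pi * (v + real j)))"
proof -
  note mono = altsinc_mono[OF v]
  have "(\<Sum>j<n. b j * rsinc (pi * (v + real j))) =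
      l * (\<Sum>j<n. (- 1) ^ j * altsinc v j) + (\<Sum>j<n. ((- 1) ^ j * (b j - l)) * altsinc v j)"
    unfolding sum_distrib_left sum.distrib[symmetric]
    by (intro sum.cong) (auto simp: altsinc_def algebra_simps simp flip: power_add)
  moreover have "\<bar>\<Sum>j<n. ((- 1) ^ j * (b j - l)) * altsinc v j\<bar> \<le> 2 * altsinc v 0"
    using mono B by (intro abel_sum_bound)
  moreover have "(if v \<le> 1 / 2 then 1 / 3 else 0) \<le> (\<Sum>j<n. (- 1) ^ j * altsinc v j)"
    using alternating_sum_lower[of "altsinc v" n] alternating_sum_bounds[of "altsinc v" n]
      mono(1,2) n altsinc_gap[of v] v by auto
  then have "l * (if v \<le> 1 / 2 then 1 / 3 else 0) \<le> l * (\<Sum>j<n. (- 1) ^ j * altsinc v j)"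
    using l by (rule mult_left_mono)
  ultimately show ?thesis using mono(3) by linarith
qed

lemma sum_lessThan_add:
  fixes f :: "nat \<Rightarrow> 'b :: comm_monoid_add"
  shows "(\<Sum>j<m + n. f j) = (\<Sum>j<m. f j) + (\<Sum>j<n. f (m + j))"
  by (induction n) (auto simp: add.assoc)

lemma bulk_lower:
  fixes g :: "nat \<Rightarrow> real"
  assumes y: "0 \<le> y" "y < real N - 1" and l: "0 \<le> l"
    and S: "\<And>i. i \<le> N \<Longrightarrow> \<bar>\<Sum>j<i. (- 1) ^ j * (g j - l)\<bar> \<le> 1"
  shows "l / 3 - 4 \<le> (\<Sum>j<N. g j * rsinc (pi * (y - real j)))"
proof -
  \<comment> \<open>The point y lies in [q - 1, q), so its distances to the first integers on the
    left and on the right add up to 1 and one of them is at most 1/2. The bound y < N - 1 keeps q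
    below N, hence both sides nonempty.\<close>
  define q where "q = Suc (nat \<lfloor>y\<rfloor>)"
  have q: "real q - 1 \<le> y" "y < real q" using y unfolding q_def by linarith+
  have qN: "q < N" using q y by linarith
  define S where "S = (\<lambda>i. \<Sum>j<i. (- 1) ^ j * (g j - l))"
  have Sb: "\<bar>S i\<bar> \<le> 1" if "i \<le> N" for i using assms(4)[OF that] by (simp add: S_def)
  have "(\<Sum>j<N. g j * rsinc (pi * (y - real j))) =
      (\<Sum>j<q. g j * rsinc (pi * (y - real j))) + (\<Sum>j<N - q. g (q + j) * rsinc (pi * (y - real (q + j))))"
    using sum_lessThan_add[of "\<lambda>j. g j * rsinc (pi * (y - real j))" q "N - q"] qN
    by (simp only: le_add_diff_inverse less_imp_le)
  moreover have "l * (if real q - y \<le> 1 / 2 then 1 / 3 else 0) - 2 \<le>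
      (\<Sum>j<N - q. g (q + j) * rsinc (pi * ((real q - y) + real j)))"
  proof (rule half_bulk_lower)
    fix i assume i: "i \<le> N - q"
    \<comment> \<open>Counted outwards from q, the alternating sums are, up to sign, differences of
      two values of the walk \<open>S\<close>. This turns the bound 1 into the bound 2 required on
      each side.\<close>
    have "(- 1) ^ q * (\<Sum>j<i. (- 1) ^ j * (g (q + j) - l)) = S (q + i) - S q"
    proof (induction i)
      case (Suc i)
      then show ?case by (simp add: S_def distrib_left power_add)
    qed simp
    note eq = this
    have "\<bar>\<Sum>j<i. (- 1) ^ j * (g (q + j) - l)\<bar> = \<bar>S (q + i) - S q\<bar>"
      unfolding eq[symmetric] by (simp add: abs_mult)
    then show "\<bar>\<Sum>j<i. (- 1) ^ j * (g (q + j) - l)\<bar> \<le> 2"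
      using Sb[of "q + i"] Sb[of q] i qN by linarith
  qed (use q qN l in auto)
  moreover have "rsinc (pi * (y - real (q + j))) = rsinc (pi * ((real q - y) + real j))" for j
  proof -
    have "pi * (y - real (q + j)) = - (pi * ((real q - y) + real j))" by (simp add: algebra_simps)
    then show ?thesis by (simp only: rsinc_minus)
  qed
  moreover have "l * (if y - (real q - 1) \<le> 1 / 2 then 1 / 3 else 0) - 2 \<le>
      (\<Sum>j<q. g (q - Suc j) * rsinc (pi * ((y - (real q - 1)) + real j)))"
  proof (rule half_bulk_lower)
    fix i assume i: "i \<le> q"
    have "(- 1) ^ q * (\<Sum>j<i. (- 1) ^ j * (g (q - Suc j) - l)) = S (q - i) - S q"
      using i
    proof (induction i)
      case (Suc i)
      define p where "p = q - Suc i"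
      have p: "q = Suc (p + i)" using Suc.prems by (simp add: p_def)
      \<comment> \<open>The count to the left starts at q - 1, not at q, which produces one extra
        sign; hence the difference is \<open>S (q - i) - S q\<close>.\<close>
      have "(- 1 :: real) ^ q * (- 1) ^ i = - ((- 1) ^ p)"
        by (simp add: p power_add mult.assoc)
      then have "(- 1) ^ q * ((- 1) ^ i * (g p - l)) = - ((- 1) ^ p * (g p - l))"
        by (simp only: mult.assoc[symmetric] mult_minus_left)
      moreover have "S (q - i) = S p + (- 1) ^ p * (g p - l)" by (simp add: p S_def)
      moreover have "(- 1) ^ q * (\<Sum>j<i. (- 1) ^ j * (g (q - Suc j) - l)) = S (q - i) - S q"
        using Suc by simp
      ultimately show ?case by (simp add: distrib_left flip: p_def)
    qed simp
    note eq = this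
    have "\<bar>\<Sum>j<i. (- 1) ^ j * (g (q - Suc j) - l)\<bar> = \<bar>S (q - i) - S q\<bar>"
      unfolding eq[symmetric] by (simp add: abs_mult)
    then show "\<bar>\<Sum>j<i. (- 1) ^ j * (g (q - Suc j) - l)\<bar> \<le> 2"
      using Sb[of "q - i"] Sb[of q] i qN by linarith
  qed (use q l in \<open>auto simp: q_def\<close>)
  moreover have "(\<Sum>j<q. g (q - Suc j) * rsinc (pi * ((y - (real q - 1)) + real j))) =
      (\<Sum>j<q. g j * rsinc (pi * (y - real j)))"
    by (subst sum.nat_diff_reindex[symmetric], rule sum.cong) (auto simp: of_nat_diff algebra_simps)
  ultimately have "l * (if real q - y \<le> 1 / 2 then 1 / 3 else 0) +
      l * (if y - (real q - 1) \<le> 1 / 2 then 1 / 3 else 0) - 4 \<le> (\<Sum>j<N. g j * rsinc (pi * (y - real j)))"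
    by simp
  moreover have "l / 3 \<le> l * (if real q - y \<le> 1 / 2 then 1 / 3 else 0) +
      l * (if y - (real q - 1) \<le> 1 / 2 then 1 / 3 else 0)"
    using l by simp
  ultimately show ?thesis by linarith
qed

section \<open>The two-sided series\<close>

definition pos_half :: "(int \<Rightarrow> real) \<Rightarrow> nat \<Rightarrow> real" where
  "pos_half a k = a (int k)"

definition neg_half :: "(int \<Rightarrow> real) \<Rightarrow> nat \<Rightarrow> real" where
  "neg_half a k = a (- int (Suc k))"

definition convergent_coeffs :: "(int \<Rightarrow> real) \<Rightarrow> bool" where
  "convergent_coeffs a \<longleftrightarrow> admissible (pos_half a) \<and> admissible (neg_half a)"

text \<open>The reflection x \<mapsto> - x - 1 takes the integer -(k + 1) to k, and the kernel is
  even. All one-sided estimates thereby serve the negative half too.\<close>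

definition real_series :: "(int \<Rightarrow> real) \<Rightarrow> real \<Rightarrow> real" where
  "real_series a x = half_series (pos_half a) x + half_series (neg_half a) (- x - 1)"

lemma summable_half: "admissible d \<Longrightarrow> summable (\<lambda>k. d k * rsinc (pi * (x - real k)))"
  using half_sums sums_summable by blast

lemma continuous_on_real_series:
  assumes "convergent_coeffs a"
  shows "continuous_on A (real_series a)"
proof -
  have "continuous_on A (\<lambda>x. half_series (pos_half a) x + half_series (neg_half a) (- x - 1))"
    using assms unfolding convergent_coeffs_def
    by (intro continuous_intros continuous_on_compose2[OF continuous_on_half_series, of "neg_half a"]
        continuous_on_subset[OF continuous_on_half_series, of "pos_half a"]) auto
  then show ?thesis by (simp add: real_series_def[abs_def])
qed

lemma sinc_series_of_real:
  assumes "convergent_coeffs a"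
  shows "sinc_series a (of_real x) = of_real (real_series a x)"
proof -
  have p: "complex_of_real (a (int k)) * csinc (of_real pi * (of_real x - of_int (int k))) =
      of_real (pos_half a k * rsinc (pi * (x - real k)))" for k
  proof -
    have "complex_of_real pi * (of_real x - of_int (int k)) = of_real (pi * (x - real k))" by simp
    then have "csinc (of_real pi * (of_real x - of_int (int k))) = of_real (rsinc (pi * (x - real k)))"
      by (simp only: csinc_of_real)
    then show ?thesis by (simp only: pos_half_def of_real_mult)
  qed
  have n: "complex_of_real (a (- int (Suc k))) *
        csinc (of_real pi * (of_real x - of_int (- int (Suc k)))) =
      of_real (neg_half a k * rsinc (pi * (- x - 1 - real k)))" for k
  proof -
    have "complex_of_real pi * (of_real x - of_int (- int (Suc k))) =
        of_real (- (pi * (- x - 1 - real k)))"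
      by (simp add: algebra_simps)
    then have "csinc (of_real pi * (of_real x - of_int (- int (Suc k)))) =
        of_real (rsinc (pi * (- x - 1 - real k)))"
      by (simp only: csinc_of_real rsinc_minus)
    then show ?thesis by (simp only: neg_half_def of_real_mult)
  qed
  show ?thesis
    using assms unfolding sinc_series_def p n real_series_def half_series_def convergent_coeffs_def
    by (simp add: summable_half suminf_of_real)
qed

lemma half_series_nat: "half_series d (real m) = d m"
proof -
  have "d k * rsinc (pi * (real m - real k)) = (if k = m then d m else 0)" for k
    using rsinc_pi_int[of "int m - int k"] by (auto split: if_splits)
  then show ?thesis
    unfolding half_series_def using sums_single[of m d]
    by (intro sums_unique[symmetric]) (simp cong: if_cong add: eq_commute)
qed

lemma half_series_neg: "half_series d (- real m - 1) = 0"
proof -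
  have "rsinc (pi * (- real m - 1 - real k)) = 0" for k
    using rsinc_pi_int[of "- int m - 1 - int k"] by simp
  then show ?thesis unfolding half_series_def by simp
qed

text \<open>At an integer at most one term is nonzero, so no convergence of the coefficients
  enters.\<close>

lemma real_series_int: "real_series a (of_int n) = a n"
proof (cases n rule: int_cases)
  case (nonneg m)
  then show ?thesis
    by (simp add: real_series_def half_series_nat half_series_neg pos_half_def)
next
  case (neg m)
  have "- real_of_int n - 1 = real m" "real_of_int n = - real m - 1" using neg by auto
  then show ?thesis using neg
    by (simp only: real_series_def half_series_nat half_series_neg neg_half_def add_0)
qed

lemma half_series_split:
  assumes "admissible d"
  shows "half_series d x = (\<Sum>k<K. d k * rsinc (pi * (x - real k))) +
    (\<Sum>k. d (k + K) * rsinc (pi * (x - real (k + K))))"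
  unfolding half_series_def
  by (rule trans[OF suminf_split_initial_segment[OF summable_half[OF assms]] add.commute])

text \<open>The budget: the bulk gives at least 30/3 - 4 = 6 and each tail takes at most 2. The
  margin in |x| \<le> R - 1 serves both halves, whose estimates involve |x + 1| and |x|.\<close>

lemma real_series_pos:
  assumes conv: "convergent_coeffs a" and x: "\<bar>x\<bar> \<le> R - 1" "2 * R \<le> real K"
    and tails: "\<bar>signed_tail K (pos_half a)\<bar> \<le> 1" "R * abs_tail K (pos_half a) \<le> 1"
      "\<bar>signed_tail K (neg_half a)\<bar> \<le> 1" "R * abs_tail K (neg_half a) \<le> 1"
    and walk: "\<And>i. i \<le> 2 * K \<Longrightarrow> \<bar>\<Sum>j<i. (- 1) ^ j * (a (int j - int K) - 30)\<bar> \<le> 1"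
  shows "0 < real_series a x"
proof -
  have tail: "\<bar>\<Sum>k. d (k + K) * rsinc (pi * (y - real (k + K)))\<bar> \<le> 2"
    if "admissible d" "\<bar>y + 1\<bar> \<le> R" "\<bar>signed_tail K d\<bar> \<le> 1" "R * abs_tail K d \<le> 1" for d y
  proof -
    have "\<bar>\<Sum>k. d (k + K) * rsinc (pi * (y - real (k + K)))\<bar> \<le>
        \<bar>signed_tail K d\<bar> + \<bar>y + 1\<bar> * abs_tail K d"
      using that x by (intro half_tail_bound) auto
    moreover have "\<bar>y + 1\<bar> * abs_tail K d \<le> R * abs_tail K d"
      using that abs_tail_nonneg by (intro mult_right_mono) auto
    ultimately show ?thesis using that by linarith
  qed
  have ad: "admissible (pos_half a)" "admissible (neg_half a)"
    using conv by (auto simp: convergent_coeffs_def)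
  define g where "g = (\<lambda>j. a (int j - int K))"
  \<comment> \<open>Shifting by K makes the indices -K, ..., K - 1 start at 0.\<close>
  have "30 / 3 - 4 \<le> (\<Sum>j<2 * K. g j * rsinc (pi * ((x + real K) - real j)))"
    using x walk unfolding g_def by (intro bulk_lower) auto
  also have "\<dots> = (\<Sum>j<K. g j * rsinc (pi * ((x + real K) - real j))) +
      (\<Sum>j<K. g (K + j) * rsinc (pi * ((x + real K) - real (K + j))))"
    unfolding mult_2 by (rule sum_lessThan_add)
  also have "(\<Sum>j<K. g (K + j) * rsinc (pi * ((x + real K) - real (K + j)))) =
      (\<Sum>k<K. pos_half a k * rsinc (pi * (x - real k)))"
    by (simp add: g_def pos_half_def)
  also have "(\<Sum>j<K. g j * rsinc (pi * ((x + real K) - real j))) =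
      (\<Sum>k<K. neg_half a k * rsinc (pi * (- x - 1 - real k)))"
  proof (subst sum.nat_diff_reindex[symmetric], rule sum.cong)
    fix k assume k: "k \<in> {..<K}"
    have "pi * ((x + real K) - real (K - Suc k)) = - (pi * (- x - 1 - real k))"
      using k by (simp add: of_nat_diff algebra_simps)
    then have "rsinc (pi * ((x + real K) - real (K - Suc k))) = rsinc (pi * (- x - 1 - real k))"
      by (simp only: rsinc_minus)
    moreover have "g (K - Suc k) = neg_half a k"
      using k by (simp add: g_def neg_half_def of_nat_diff)
    ultimately show "g (K - Suc k) * rsinc (pi * ((x + real K) - real (K - Suc k))) =
        neg_half a k * rsinc (pi * (- x - 1 - real k))" by simp
  qed simp
  finally have "6 \<le> (\<Sum>k<K. neg_half a k * rsinc (pi * (- x - 1 - real k))) +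
      (\<Sum>k<K. pos_half a k * rsinc (pi * (x - real k)))" by simp
  moreover have "\<bar>x + 1\<bar> \<le> R" "\<bar>(- x - 1) + 1\<bar> \<le> R" using x by auto
  ultimately show ?thesis
    unfolding real_series_def half_series_split[OF ad(1), of x K]
      half_series_split[OF ad(2), of "- x - 1" K]
    using tail[OF ad(1) _ tails(1,2), of x] tail[OF ad(2) _ tails(3,4), of "- x - 1"]
    by linarith
qed

text \<open>For independent standard Gaussians \<open>E (W n)\<^sup>4 = 3 n\<^sup>2\<close>, so the hypothesis below holds almost
  surely. Fourth moments thus replace a maximal inequality for the a.s. convergence.\<close>

lemma summable_of_partial_sums:
  fixes c :: "nat \<Rightarrow> real"
  defines "W \<equiv> \<lambda>n. \<Sum>k<n. c k"
  assumes s: "summable (\<lambda>n. W (Suc n) ^ 4 / real (Suc n) powr (16 / 5))"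
  shows "summable (\<lambda>k. c k / (real k + 1))"
proof -
  \<comment> \<open>Any exponent strictly between 3 and 4 would do. Above 3 it makes n^2 / n^(16/5)
    summable; below 4 it gives W n = O(n^(4/5)), so that W n / n tends to 0 and the terms W n / n^2
    left by summation by parts are summable.\<close>
  have "Bseq (\<lambda>n. W (Suc n) ^ 4 / real (Suc n) powr (16 / 5))"
    using summable_LIMSEQ_zero[OF s] by (intro convergent_imp_Bseq convergentI)
  then obtain B where B: "B > 0" "\<And>n. \<bar>W (Suc n) ^ 4 / real (Suc n) powr (16 / 5)\<bar> \<le> B"
    by (auto simp: Bseq_def)
  define b where "b = B powr (1 / 4)"
  have W: "\<bar>W (Suc n)\<bar> \<le> b * real (Suc n) powr (4 / 5)" for n
  proof (rule power_le_imp_le_base)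
    have "W (Suc n) ^ 4 \<le> B * real (Suc n) powr (16 / 5)"
      using B(2)[of n] by (simp add: pos_divide_le_eq)
    also have "\<dots> = (b * real (Suc n) powr (4 / 5)) ^ Suc 3"
    proof -
      have "b ^ 4 = B" using B(1) by (simp add: b_def powr_power)
      moreover have "(real (Suc n) powr (4 / 5)) ^ 4 = real (Suc n) powr (16 / 5)"
        by (simp add: powr_power)
      ultimately show ?thesis by (simp add: power_mult_distrib flip: numeral_eq_Suc)
    qed
    finally show "\<bar>W (Suc n)\<bar> ^ Suc 3 \<le> (b * real (Suc n) powr (4 / 5)) ^ Suc 3"
      by (simp flip: numeral_eq_Suc)
  qed (simp add: b_def)
  have b0: "0 \<le> b" by (simp add: b_def)
  have "summable (\<lambda>k. W (Suc k) * (1 / (real k + 1) - 1 / (real k + 2)))"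
  proof (rule summable_comparison_test)
    show "summable (\<lambda>k. b * real (Suc k) powr (- (6 / 5)))"
    proof (intro summable_mult)
      have "summable (\<lambda>k. real k powr (- (6 / 5)))" by (simp add: summable_real_powr_iff)
      then show "summable (\<lambda>k. real (Suc k) powr (- (6 / 5)))"
        by (subst summable_Suc_iff)
    qed
    show "\<exists>N. \<forall>k\<ge>N. norm (W (Suc k) * (1 / (real k + 1) - 1 / (real k + 2)))
        \<le> b * real (Suc k) powr (- (6 / 5))"
    proof (intro exI allI impI)
      fix k :: nat
      have "1 / (real k + 1) - 1 / (real k + 2) = 1 / ((real k + 1) * (real k + 2))"
        by (simp add: divide_simps)
      moreover have "1 / ((real k + 1) * (real k + 2)) \<le> 1 / ((real k + 1) * (real k + 1))"
        by (intro divide_left_mono mult_left_mono) auto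
      moreover have "1 / ((real k + 1) * (real k + 1)) = real (Suc k) powr (- 2)"
        by (simp add: powr_minus_divide power2_eq_square add.commute)
      ultimately have le: "\<bar>1 / (real k + 1) - 1 / (real k + 2)\<bar> \<le> real (Suc k) powr (- 2)"
        by simp
      have "\<bar>W (Suc k)\<bar> * \<bar>1 / (real k + 1) - 1 / (real k + 2)\<bar> \<le>
          (b * real (Suc k) powr (4 / 5)) * real (Suc k) powr (- 2)"
        using W le b0 by (intro mult_mono) auto
      also have "\<dots> = b * real (Suc k) powr (- (6 / 5))"
        by (simp add: mult.assoc flip: powr_add)
      finally show "norm (W (Suc k) * (1 / (real k + 1) - 1 / (real k + 2)))
          \<le> b * real (Suc k) powr (- (6 / 5))"
        by (simp add: abs_mult)
    qed
  qed
  then have "(\<lambda>n. \<Sum>k<n. W (Suc k) * (1 / (real k + 1) - 1 / (real k + 2)))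
      \<longlonglongrightarrow> (\<Sum>k. W (Suc k) * (1 / (real k + 1) - 1 / (real k + 2)))"
    by (rule summable_LIMSEQ)
  then have A: "(\<lambda>n. \<Sum>k<Suc n. W (Suc k) * (1 / (real k + 1) - 1 / (real k + 2)))
      \<longlonglongrightarrow> (\<Sum>k. W (Suc k) * (1 / (real k + 1) - 1 / (real k + 2)))"
    by (rule LIMSEQ_Suc)
  have B: "(\<lambda>n. W (Suc n) / (real n + 2)) \<longlonglongrightarrow> 0"
  proof (rule Lim_null_comparison)
    have "(\<lambda>n. real n powr (- (1 / 5))) \<longlonglongrightarrow> 0"
      by (intro tendsto_neg_powr filterlim_real_sequentially) auto
    then have "(\<lambda>n. b * real (Suc n) powr (- (1 / 5))) \<longlonglongrightarrow> b * 0"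
      by (intro tendsto_mult tendsto_const LIMSEQ_Suc)
    then show "(\<lambda>n. b * real (Suc n) powr (- (1 / 5))) \<longlonglongrightarrow> 0" by simp
    show "\<forall>\<^sub>F n in sequentially. norm (W (Suc n) / (real n + 2)) \<le> b * real (Suc n) powr (- (1 / 5))"
    proof (intro always_eventually allI)
      fix n :: nat
      have "\<bar>W (Suc n)\<bar> / (real n + 2) \<le> \<bar>W (Suc n)\<bar> / (real n + 1)"
        by (intro divide_left_mono) auto
      also have "\<dots> \<le> (b * real (Suc n) powr (4 / 5)) / (real n + 1)"
        by (intro divide_right_mono W) auto
      also have "\<dots> = b * (real (Suc n) powr (4 / 5) * real (Suc n) powr (- 1))"
        by (simp add: powr_minus_divide add.commute)
      also have "\<dots> = b * real (Suc n) powr (4 / 5 + - 1)"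
        by (simp only: powr_add)
      also have "\<dots> = b * real (Suc n) powr (- (1 / 5))"
        by simp
      finally show "norm (W (Suc n) / (real n + 2)) \<le> b * real (Suc n) powr (- (1 / 5))" by simp
    qed
  qed
  have parts: "(\<Sum>k<n. c k / (real k + 1)) =
      (\<Sum>k<n. W (Suc k) * (1 / (real k + 1) - 1 / (real k + 2))) + W n / (real n + 1)" for n
  proof (induction n)
    case (Suc n)
    have "c n = W (Suc n) - W n" by (simp add: W_def)
    then have "c n / (real n + 1) = W (Suc n) / (real n + 1) - W n / (real n + 1)"
      by (simp only: diff_divide_distrib)
    with Suc show ?case by (simp add: algebra_simps)
  qed (simp add: W_def)
  have "(\<lambda>n. \<Sum>k<Suc n. c k / (real k + 1)) \<longlonglongrightarrow> (\<Sum>k. W (Suc k) * (1 / (real k + 1) - 1 / (real k + 2))) + 0"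
    unfolding parts using tendsto_add[OF A B] by (simp add: add.commute add.left_commute)
  then have "(\<lambda>n. \<Sum>k<n. c k / (real k + 1)) \<longlonglongrightarrow> (\<Sum>k. W (Suc k) * (1 / (real k + 1) - 1 / (real k + 2)))"
    by (intro LIMSEQ_imp_Suc[where f = "\<lambda>n. \<Sum>k<n. c k / (real k + 1)"]) simp
  then show ?thesis
    by (auto simp: summable_def sums_def)
qed

lemma inverse_square_tail:
  assumes "0 < K"
  shows "(\<Sum>k<n. 1 / (real (k + K) + 1)\<^sup>2) \<le> 1 / real K"
proof -
  have "(\<Sum>k<n. 1 / (real (k + K) + 1)\<^sup>2) \<le> 1 / real K - 1 / real (n + K)"
  proof (induction n)
    case (Suc n)
    have "1 / (real (n + K) + 1)\<^sup>2 \<le> 1 / (real (n + K) * (real (n + K) + 1))"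
      unfolding power2_eq_square using assms by (intro divide_left_mono mult_right_mono) auto
    also have "\<dots> = 1 / real (n + K) - 1 / real (Suc n + K)"
      using assms by (simp add: divide_simps)
    finally show ?case using Suc by simp
  qed simp
  moreover have "0 \<le> 1 / real (n + K)" by simp
  ultimately show ?thesis by linarith
qed

text \<open>For measurability of the hole event: the right-hand side uses only countably many
  evaluations of \<open>F\<close>. The open interval is exhausted by compact ones, and on a compact
  interval |F| attains its minimum, which is 0 once |F| is arbitrarily small at rational points
  there.\<close>

lemma zero_in_interval_iff_rat:
  fixes F :: "real \<Rightarrow> real"
  assumes cont: "continuous_on UNIV F"
  shows "(\<exists>x\<in>{-r<..<r}. F x = 0) \<longleftrightarrow>
    (\<exists>m::nat. \<forall>k::nat. \<exists>q::rat. \<bar>real_of_rat q\<bar> \<le> r - 1 / real (Suc m) \<and> \<bar>F (real_of_rat q)\<bar> < 1 / real (Suc k))"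
proof
  assume "\<exists>x\<in>{-r<..<r}. F x = 0"
  then obtain x where "- r < x" "x < r" "F x = 0" by auto
  then have x: "\<bar>x\<bar> < r" "F x = 0" by auto
  obtain m where m: "inverse (real (Suc m)) < r - \<bar>x\<bar>"
    using reals_Archimedean[of "r - \<bar>x\<bar>"] x by auto
  have "\<exists>q::rat. \<bar>real_of_rat q\<bar> \<le> r - 1 / real (Suc m) \<and> \<bar>F (real_of_rat q)\<bar> < 1 / real (Suc k)" for k
  proof -
    have "isCont F x" using cont by (simp add: continuous_on_eq_continuous_at)
    then obtain d where d: "d > 0" "\<And>y. \<bar>y - x\<bar> < d \<Longrightarrow> \<bar>F y\<bar> < 1 / real (Suc k)"
      using x(2) unfolding continuous_at_eps_delta
      by (metis diff_zero dist_real_def of_nat_0_less_iff zero_less_Suc zero_less_divide_1_iff)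
    define e where "e = min d (r - 1 / real (Suc m) - \<bar>x\<bar>)"
    have e: "0 < e" using d m by (simp add: e_def inverse_eq_divide)
    obtain q where q: "x < real_of_rat q" "real_of_rat q < x + e"
      using of_rat_dense[of x "x + e"] e by auto
    then have near: "\<bar>real_of_rat q - x\<bar> < e" by auto
    then have "\<bar>real_of_rat q\<bar> \<le> r - 1 / real (Suc m)"
      unfolding e_def by linarith
    moreover have "\<bar>F (real_of_rat q)\<bar> < 1 / real (Suc k)"
      using near by (intro d(2)) (simp add: e_def)
    ultimately show ?thesis by blast
  qed
  then show "\<exists>m::nat. \<forall>k::nat. \<exists>q::rat. \<bar>real_of_rat q\<bar> \<le> r - 1 / real (Suc m) \<and>
      \<bar>F (real_of_rat q)\<bar> < 1 / real (Suc k)" by blast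
next
  assume "\<exists>m::nat. \<forall>k::nat. \<exists>q::rat. \<bar>real_of_rat q\<bar> \<le> r - 1 / real (Suc m) \<and>
      \<bar>F (real_of_rat q)\<bar> < 1 / real (Suc k)"
  then obtain m where m: "\<And>k::nat. \<exists>q::rat. \<bar>real_of_rat q\<bar> \<le> r - 1 / real (Suc m) \<and>
      \<bar>F (real_of_rat q)\<bar> < 1 / real (Suc k)" by blast
  define s where "s = r - 1 / real (Suc m)"
  obtain q0 :: rat where "\<bar>real_of_rat q0\<bar> \<le> s" using m unfolding s_def by blast
  then have s: "0 \<le> s" by (rule order_trans[OF abs_ge_zero])
  have "\<exists>x\<in>{-s..s}. \<forall>y\<in>{-s..s}. \<bar>F x\<bar> \<le> \<bar>F y\<bar>"
    using s by (intro continuous_attains_inf continuous_intros continuous_on_subset[OF cont]) auto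
  then obtain x where x: "x \<in> {-s..s}" "\<And>y. y \<in> {-s..s} \<Longrightarrow> \<bar>F x\<bar> \<le> \<bar>F y\<bar>" by blast
  have "F x = 0"
  proof (rule ccontr)
    assume "F x \<noteq> 0"
    then obtain k where k: "inverse (real (Suc k)) < \<bar>F x\<bar>"
      using reals_Archimedean[of "\<bar>F x\<bar>"] by auto
    from m[of k] obtain q :: rat where q: "\<bar>real_of_rat q\<bar> \<le> s" "\<bar>F (real_of_rat q)\<bar> < 1 / real (Suc k)"
      by (auto simp: s_def)
    have "real_of_rat q \<in> {-s..s}" using q(1) unfolding abs_le_iff by auto
    from x(2)[OF this] q(2) k show False by (simp add: inverse_eq_divide)
  qed
  moreover have "s < r" by (simp add: s_def)
  ultimately show "\<exists>x\<in>{-r<..<r}. F x = 0" using x(1) by (intro bexI[of _ x]) auto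
qed

section \<open>Convergence and tails\<close>

context prob_space
begin

lemma AE_summable_of_expectation:
  fixes Y :: "nat \<Rightarrow> 'a \<Rightarrow> real"
  assumes int: "\<And>n. integrable M (Y n)" and nn: "\<And>n \<omega>. 0 \<le> Y n \<omega>"
    and s: "summable (\<lambda>n. expectation (Y n))"
  shows "AE \<omega> in M. summable (\<lambda>n. Y n \<omega>)"
proof -
  have [measurable]: "Y n \<in> borel_measurable M" for n using int by auto
  have "(\<integral>\<^sup>+\<omega>. (\<Sum>n. ennreal (Y n \<omega>)) \<partial>M) = (\<Sum>n. \<integral>\<^sup>+\<omega>. ennreal (Y n \<omega>) \<partial>M)"
    by (rule nn_integral_suminf) measurable
  also have "\<dots> = (\<Sum>n. ennreal (expectation (Y n)))"
    using int nn by (intro suminf_cong nn_integral_eq_integral) auto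
  also have "\<dots> \<noteq> top"
    using s nn by (intro ennreal_suminf_neq_top) auto
  finally have "AE \<omega> in M. (\<Sum>n. ennreal (Y n \<omega>)) \<noteq> \<infinity>"
    by (intro nn_integral_noteq_infinite) auto
  then show ?thesis
    by eventually_elim (use nn in \<open>auto intro!: summable_suminf_not_top\<close>)
qed

lemma normal_moments:
  assumes D: "distributed M lborel Y (normal_density 0 s)" and s: "0 < s"
  shows "integrable M (\<lambda>\<omega>. Y \<omega> ^ 2)" "expectation (\<lambda>\<omega>. Y \<omega> ^ 2) = s ^ 2"
    "integrable M (\<lambda>\<omega>. Y \<omega> ^ 4)" "expectation (\<lambda>\<omega>. Y \<omega> ^ 4) = 3 * s ^ 4"
proof -
  have "has_bochner_integral lborel (\<lambda>x. normal_density 0 s x * x ^ 2) (s\<^sup>2)"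
    using normal_moment_even[OF s, of 0 1] by simp
  then show "integrable M (\<lambda>\<omega>. Y \<omega> ^ 2)" "expectation (\<lambda>\<omega>. Y \<omega> ^ 2) = s ^ 2"
    using distributed_integrable[OF D, of "\<lambda>x. x ^ 2"] distributed_integral[OF D, of "\<lambda>x. x ^ 2"]
    by (auto simp: has_bochner_integral_iff)
  have "fact (2 * 2) / ((2 / s\<^sup>2)\<^sup>2 * fact 2) = 3 * s ^ 4"
    using s by (simp add: fact_numeral field_simps)
  then have "has_bochner_integral lborel (\<lambda>x. normal_density 0 s x * x ^ 4) (3 * s ^ 4)"
    using normal_moment_even[OF s, of 0 2] by simp
  then show "integrable M (\<lambda>\<omega>. Y \<omega> ^ 4)" "expectation (\<lambda>\<omega>. Y \<omega> ^ 4) = 3 * s ^ 4"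
    using distributed_integrable[OF D, of "\<lambda>x. x ^ 4"] distributed_integral[OF D, of "\<lambda>x. x ^ 4"]
    by (auto simp: has_bochner_integral_iff)
qed

end

locale iid_gaussian = prob_space M for M :: "'a measure" +
  fixes a :: "int \<Rightarrow> 'a \<Rightarrow> real"
  assumes indep: "indep_vars (\<lambda>_. borel) a UNIV"
    and dist: "\<And>n. distributed M lborel (a n) std_normal_density"
begin

lemma measurable_a [measurable]: "a n \<in> borel_measurable M"
  using distributed_measurable[OF dist, of n] by simp

lemma normal_combination:
  assumes J: "finite J" "J \<noteq> {}" and \<phi>: "inj (\<phi> :: nat \<Rightarrow> int)" and c: "\<And>k. c k \<noteq> 0"
  shows "distributed M lborel (\<lambda>\<omega>. \<Sum>k\<in>J. c k * a (\<phi> k) \<omega>) (normal_density 0 (sqrt (\<Sum>k\<in>J. (c k)\<^sup>2)))"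
proof -
  let ?c = "\<lambda>n. c (inv \<phi> n)"
  have inj: "inj_on \<phi> J" using \<phi> by (rule inj_on_subset) simp
  have "distributed M lborel (\<lambda>\<omega>. \<Sum>n\<in>\<phi> ` J. ?c n * a n \<omega>)
      (normal_density (\<Sum>n\<in>\<phi> ` J. 0) (sqrt (\<Sum>n\<in>\<phi> ` J. \<bar>?c n\<bar>\<^sup>2)))"
  proof (rule sum_indep_normal)
    show "indep_vars (\<lambda>_. borel) (\<lambda>n \<omega>. ?c n * a n \<omega>) (\<phi> ` J)"
      by (rule indep_vars_compose2[where Y = "\<lambda>n x. ?c n * x" and M' = "\<lambda>_. borel"])
        (auto intro: indep_vars_subset[OF indep])
    show "distributed M lborel (\<lambda>\<omega>. ?c n * a n \<omega>) (normal_density 0 \<bar>?c n\<bar>)" for n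
      using normal_density_affine[OF dist[of n], of "?c n" 0] c by simp
  qed (use J c in auto)
  then show ?thesis
    using \<phi> by (simp add: sum.reindex[OF inj])
qed

lemma second_moment: "integrable M (\<lambda>\<omega>. (a n \<omega>)\<^sup>2)" "expectation (\<lambda>\<omega>. (a n \<omega>)\<^sup>2) = 1"
  using normal_moments(1,2)[OF dist] by auto

lemma abs_moment: "integrable M (\<lambda>\<omega>. \<bar>a n \<omega>\<bar>)" "expectation (\<lambda>\<omega>. \<bar>a n \<omega>\<bar>) \<le> 1"
proof -
  have le: "\<bar>t\<bar> \<le> (1 + t\<^sup>2) / 2" for t :: real
    using zero_le_power2[of "\<bar>t\<bar> - 1"] by (simp add: power2_diff)
  have i: "integrable M (\<lambda>\<omega>. (1 + (a n \<omega>)\<^sup>2) / 2)"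
    using second_moment by simp
  show 1: "integrable M (\<lambda>\<omega>. \<bar>a n \<omega>\<bar>)"
    by (rule Bochner_Integration.integrable_bound[OF i]) (use le in \<open>auto simp: abs_of_nonneg\<close>)
  have "expectation (\<lambda>\<omega>. \<bar>a n \<omega>\<bar>) \<le> expectation (\<lambda>\<omega>. (1 + (a n \<omega>)\<^sup>2) / 2)"
    by (intro integral_mono 1 i le)
  also have "\<dots> = 1" using second_moment by (simp add: prob_space)
  finally show "expectation (\<lambda>\<omega>. \<bar>a n \<omega>\<bar>) \<le> 1" .
qed

text \<open>An arbitrary injection \<phi> covers both halves at once. The absolute part follows from
  bounded first moments; for the conditional part the signs square to 1, so the alternating sum of n
  terms is normal with variance n and fourth moment 3 n^2.\<close>

lemma AE_admissible:
  assumes \<phi>: "inj (\<phi> :: nat \<Rightarrow> int)"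
  shows "AE \<omega> in M. admissible (\<lambda>k. a (\<phi> k) \<omega>)"
proof -
  have sq: "summable (\<lambda>k. 1 / (real k + 1)\<^sup>2)"
    using summable_Suc_iff[of "\<lambda>k. 1 / (real k)\<^sup>2"] inverse_power_summable[of 2, where 'a = real]
    by (simp add: inverse_eq_divide add.commute)
  have "AE \<omega> in M. summable (\<lambda>k. \<bar>a (\<phi> k) \<omega>\<bar> / (real k + 1)\<^sup>2)"
  proof (rule AE_summable_of_expectation)
    show "summable (\<lambda>k. expectation (\<lambda>\<omega>. \<bar>a (\<phi> k) \<omega>\<bar> / (real k + 1)\<^sup>2))"
      by (rule summable_comparison_test[OF _ sq])
        (use abs_moment in \<open>auto intro!: exI[of _ 0] divide_right_mono simp: abs_of_nonneg\<close>)
  qed (use abs_moment in auto)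
  moreover
  define W where "W = (\<lambda>n \<omega>. \<Sum>k<n. (- 1) ^ k * a (\<phi> k) \<omega>)"
  have D: "distributed M lborel (W (Suc n)) (normal_density 0 (sqrt (real (Suc n))))" for n
  proof -
    have "(\<Sum>k<Suc n. ((- 1 :: real) ^ k)\<^sup>2) = real (Suc n)"
      by (simp flip: power_mult del: sum.lessThan_Suc)
    moreover have "{..<Suc n} \<noteq> {}" by auto
    ultimately show ?thesis
      using normal_combination[of "{..<Suc n}" \<phi> "\<lambda>k. (- 1) ^ k"] \<phi>
      unfolding W_def by (simp del: sum.lessThan_Suc)
  qed
  have "AE \<omega> in M. summable (\<lambda>n. W (Suc n) \<omega> ^ 4 / real (Suc n) powr (16 / 5))"
  proof (rule AE_summable_of_expectation)
    show "integrable M (\<lambda>\<omega>. W (Suc n) \<omega> ^ 4 / real (Suc n) powr (16 / 5))" for n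
      using normal_moments(3)[OF D[of n]] by simp
    have "expectation (\<lambda>\<omega>. W (Suc n) \<omega> ^ 4 / real (Suc n) powr (16 / 5)) =
        3 * real (Suc n) powr (- (6 / 5))" for n
    proof -
      have "expectation (\<lambda>\<omega>. W (Suc n) \<omega> ^ 4 / real (Suc n) powr (16 / 5)) =
          3 * sqrt (real (Suc n)) ^ 4 / real (Suc n) powr (16 / 5)"
        using normal_moments(4)[OF D[of n]] by simp
      also have "sqrt (real (Suc n)) ^ 4 = (sqrt (real (Suc n)) ^ 2) ^ 2"
        by (simp only: power_mult[symmetric]) simp
      also have "\<dots> = real (Suc n) powr 2" by simp
      also have "3 * real (Suc n) powr 2 / real (Suc n) powr (16 / 5) = 3 * real (Suc n) powr (2 - 16 / 5)"
        by (simp only: powr_diff times_divide_eq_right)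
      finally show ?thesis by simp
    qed
    moreover have "summable (\<lambda>k. real k powr (- (6 / 5)))" by (simp add: summable_real_powr_iff)
    then have "summable (\<lambda>k. real (Suc k) powr (- (6 / 5)))" by (subst summable_Suc_iff)
    ultimately show "summable (\<lambda>n. expectation (\<lambda>\<omega>. W (Suc n) \<omega> ^ 4 / real (Suc n) powr (16 / 5)))"
      by (simp only: summable_mult)
  qed simp
  then have "AE \<omega> in M. summable (\<lambda>k. (- 1) ^ k * a (\<phi> k) \<omega> / (real k + 1))"
    by eventually_elim (use summable_of_partial_sums in \<open>auto simp: W_def\<close>)
  ultimately show ?thesis
    by eventually_elim (simp add: admissible_def)
qed

lemma inj_halves: "inj int" "inj (\<lambda>k. - int (Suc k))"
  by (auto simp: inj_def)

lemma AE_convergent: "AE \<omega> in M. convergent_coeffs (\<lambda>n. a n \<omega>)"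
  using AE_admissible[OF inj_halves(1)] AE_admissible[OF inj_halves(2)]
  by eventually_elim (simp add: convergent_coeffs_def pos_half_def[abs_def] neg_half_def[abs_def])

text \<open>Each partial sum is normal with variance at most 1/K. Fatou's lemma carries this bound
  over to the second moment of the almost sure limit, so convergence in L^2 need not be established;
  Markov's inequality for the square then concludes.\<close>

lemma prob_signed_tail:
  assumes \<phi>: "inj (\<phi> :: nat \<Rightarrow> int)" and K: "0 < K"
  shows "prob {\<omega> \<in> space M. \<not> \<bar>signed_tail K (\<lambda>k. a (\<phi> k) \<omega>)\<bar> \<le> 1} \<le> 1 / real K"
proof -
  define S where "S = (\<lambda>n \<omega>. \<Sum>k<n. (- 1) ^ (k + K) * a (\<phi> (k + K)) \<omega> / (real (k + K) + 1))"
  let ?T = "\<lambda>\<omega>. signed_tail K (\<lambda>k. a (\<phi> k) \<omega>)"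
  have [measurable]: "S n \<in> borel_measurable M" for n unfolding S_def by measurable
  have [measurable]: "?T \<in> borel_measurable M" unfolding signed_tail_def by measurable
  have le: "(\<integral>\<^sup>+\<omega>. ennreal ((S n \<omega>)\<^sup>2) \<partial>M) \<le> ennreal (1 / real K)" for n
  proof (cases "n = 0")
    case False
    let ?c = "\<lambda>k. (- 1) ^ (k + K) / (real (k + K) + 1)"
    let ?s = "sqrt (\<Sum>k<n. (?c k)\<^sup>2)"
    have inj: "inj (\<lambda>k. \<phi> (k + K))"
      by (intro injI) (auto dest!: injD[OF \<phi>])
    have "distributed M lborel (\<lambda>\<omega>. \<Sum>k<n. ?c k * a (\<phi> (k + K)) \<omega>) (normal_density 0 ?s)"
      using False by (intro normal_combination[OF _ _ inj]) auto
    then have D: "distributed M lborel (S n) (normal_density 0 ?s)"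
      by (simp add: S_def)
    have pos: "0 < (\<Sum>k<n. (?c k)\<^sup>2)"
      using False by (intro sum_pos) auto
    then have s: "0 < ?s" by simp
    have "(\<integral>\<^sup>+\<omega>. ennreal ((S n \<omega>)\<^sup>2) \<partial>M) = ennreal (expectation (\<lambda>\<omega>. (S n \<omega>)\<^sup>2))"
      using normal_moments(1)[OF D s] by (intro nn_integral_eq_integral) auto
    also have "expectation (\<lambda>\<omega>. (S n \<omega>)\<^sup>2) = (\<Sum>k<n. (?c k)\<^sup>2)"
      using normal_moments(2)[OF D s] pos by simp
    also have "\<dots> = (\<Sum>k<n. 1 / (real (k + K) + 1)\<^sup>2)"
      by (intro sum.cong) (auto simp: power_divide simp flip: power_mult)
    also have "ennreal \<dots> \<le> ennreal (1 / real K)"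
      by (intro ennreal_leI inverse_square_tail K)
    finally show ?thesis .
  qed (simp add: S_def)
  have lim: "AE \<omega> in M. (\<lambda>n. ennreal ((S n \<omega>)\<^sup>2)) \<longlonglongrightarrow> ennreal ((?T \<omega>)\<^sup>2)"
    using AE_admissible[OF \<phi>]
  proof eventually_elim
    case (elim \<omega>)
    then have "(\<lambda>n. S n \<omega>) \<longlonglongrightarrow> ?T \<omega>"
      unfolding S_def signed_tail_def by (intro summable_LIMSEQ summable_shifts)
    then show ?case by (intro tendsto_ennrealI tendsto_power)
  qed
  have "(\<integral>\<^sup>+\<omega>. ennreal ((?T \<omega>)\<^sup>2) \<partial>M) = (\<integral>\<^sup>+\<omega>. liminf (\<lambda>n. ennreal ((S n \<omega>)\<^sup>2)) \<partial>M)"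
  proof (rule nn_integral_cong_AE, use lim in eventually_elim)
    case (elim \<omega>)
    show ?case by (rule lim_imp_Liminf[symmetric, OF _ elim]) simp
  qed
  also have "\<dots> \<le> liminf (\<lambda>n. \<integral>\<^sup>+\<omega>. ennreal ((S n \<omega>)\<^sup>2) \<partial>M)"
    by (intro nn_integral_liminf) measurable
  also have "\<dots> \<le> liminf (\<lambda>n::nat. ennreal (1 / real K))"
    by (intro Liminf_mono always_eventually allI le)
  also have "\<dots> = ennreal (1 / real K)" by (simp add: Liminf_const)
  finally have int: "(\<integral>\<^sup>+\<omega>. ennreal ((?T \<omega>)\<^sup>2) \<partial>M) \<le> ennreal (1 / real K)" .
  have "emeasure M {\<omega> \<in> space M. \<not> \<bar>?T \<omega>\<bar> \<le> 1} \<le> emeasure M {\<omega> \<in> space M. 1 \<le> 1 * ennreal ((?T \<omega>)\<^sup>2)}"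
  proof (intro emeasure_mono subsetI)
    fix \<omega> assume "\<omega> \<in> {\<omega> \<in> space M. \<not> \<bar>?T \<omega>\<bar> \<le> 1}"
    moreover from this have "1 \<le> (?T \<omega>)\<^sup>2"
      using abs_le_square_iff[of 1 "?T \<omega>"] by simp
    ultimately show "\<omega> \<in> {\<omega> \<in> space M. 1 \<le> 1 * ennreal ((?T \<omega>)\<^sup>2)}"
      using ennreal_leI[of 1 "(?T \<omega>)\<^sup>2"] by simp
  qed measurable
  also have "\<dots> \<le> 1 * (\<integral>\<^sup>+\<omega>. ennreal ((?T \<omega>)\<^sup>2) * indicator (space M) \<omega> \<partial>M)"
    by (rule nn_integral_Markov_inequality) measurable
  also have "\<dots> = (\<integral>\<^sup>+\<omega>. ennreal ((?T \<omega>)\<^sup>2) \<partial>M)"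
    unfolding mult_1 by (intro nn_integral_cong) simp
  also note int
  finally show ?thesis by (simp add: emeasure_eq_measure)
qed

text \<open>All terms are nonnegative, so the first moment may be computed termwise and is at most
  1/K; Markov's inequality at level 1/R costs the factor R.\<close>

lemma prob_abs_tail:
  assumes \<phi>: "inj (\<phi> :: nat \<Rightarrow> int)" and K: "0 < K" and R: "0 \<le> R"
  shows "prob {\<omega> \<in> space M. \<not> R * abs_tail K (\<lambda>k. a (\<phi> k) \<omega>) \<le> 1} \<le> R / real K"
proof -
  let ?f = "\<lambda>k \<omega>. \<bar>a (\<phi> (k + K)) \<omega>\<bar> / (real (k + K) + 1)\<^sup>2"
  let ?U = "\<lambda>\<omega>. abs_tail K (\<lambda>k. a (\<phi> k) \<omega>)"
  have [measurable]: "?U \<in> borel_measurable M" unfolding abs_tail_def by measurable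
  have "(\<integral>\<^sup>+\<omega>. ennreal (?U \<omega>) \<partial>M) = (\<integral>\<^sup>+\<omega>. (\<Sum>k. ennreal (?f k \<omega>)) \<partial>M)"
  proof (rule nn_integral_cong_AE, use AE_admissible[OF \<phi>] in eventually_elim)
    case (elim \<omega>)
    show ?case
      unfolding abs_tail_def
      by (intro suminf_ennreal2[symmetric] summable_shifts(2)[OF elim]) auto
  qed
  also have "\<dots> = (\<Sum>k. \<integral>\<^sup>+\<omega>. ennreal (?f k \<omega>) \<partial>M)"
    by (rule nn_integral_suminf) measurable
  also have "\<dots> = (\<Sum>k. ennreal (expectation (?f k)))"
    using abs_moment(1) by (intro suminf_cong nn_integral_eq_integral) auto
  also have "\<dots> \<le> ennreal (1 / real K)"
  proof (rule suminf_le_const)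
    fix n
    have "(\<Sum>k<n. expectation (?f k)) \<le> (\<Sum>k<n. 1 / (real (k + K) + 1)\<^sup>2)"
      using abs_moment(2) by (intro sum_mono) (auto intro!: divide_right_mono)
    also have "\<dots> \<le> 1 / real K" by (rule inverse_square_tail[OF K])
    finally show "(\<Sum>k<n. ennreal (expectation (?f k))) \<le> ennreal (1 / real K)"
      by (subst sum_ennreal) (auto intro: ennreal_leI)
  qed simp
  finally have int: "(\<integral>\<^sup>+\<omega>. ennreal (?U \<omega>) \<partial>M) \<le> ennreal (1 / real K)" .
  have "emeasure M {\<omega> \<in> space M. \<not> R * ?U \<omega> \<le> 1} \<le>
      emeasure M {\<omega> \<in> space M. 1 \<le> ennreal R * ennreal (?U \<omega>)}"
  proof (intro emeasure_mono subsetI)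
    fix \<omega> assume "\<omega> \<in> {\<omega> \<in> space M. \<not> R * ?U \<omega> \<le> 1}"
    then show "\<omega> \<in> {\<omega> \<in> space M. 1 \<le> ennreal R * ennreal (?U \<omega>)}"
      using R by (simp flip: ennreal_1 add: ennreal_mult'[symmetric])
  qed measurable
  also have "\<dots> \<le> ennreal R * (\<integral>\<^sup>+\<omega>. ennreal (?U \<omega>) * indicator (space M) \<omega> \<partial>M)"
    by (rule nn_integral_Markov_inequality) measurable
  also have "(\<integral>\<^sup>+\<omega>. ennreal (?U \<omega>) * indicator (space M) \<omega> \<partial>M) = (\<integral>\<^sup>+\<omega>. ennreal (?U \<omega>) \<partial>M)"
    by (intro nn_integral_cong) simp
  also have "ennreal R * \<dots> \<le> ennreal R * ennreal (1 / real K)"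
    by (intro mult_left_mono int) simp
  also have "\<dots> = ennreal (R / real K)" using R by (simp flip: ennreal_mult)
  finally show ?thesis using R by (simp add: emeasure_eq_measure)
qed

section \<open>The confined walk\<close>

text \<open>The sigma-algebra generated by the coefficients with index in \<open>I\<close>. As a
  pullback from the product space, it presents each of its events as a preimage under a restricted
  family, the form in which independence of disjoint blocks is available.\<close>

definition generated :: "int set \<Rightarrow> 'a measure" where
  "generated I = vimage_algebra (space M) (\<lambda>\<omega>. restrict (\<lambda>n. a n \<omega>) I) (PiM I (\<lambda>_. borel))"

lemma space_generated [simp]: "space (generated I) = space M"
  by (simp add: generated_def)

lemma measurable_generated:
  assumes "n \<in> I" shows "a n \<in> borel_measurable (generated I)"
proof -
  have "(\<lambda>\<omega>. restrict (\<lambda>n. a n \<omega>) I) \<in> generated I \<rightarrow>\<^sub>M PiM I (\<lambda>_. borel)"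
    unfolding generated_def by (rule measurable_vimage_algebra1) (auto simp: space_PiM)
  from measurable_compose[OF this measurable_component_singleton[OF assms]] show ?thesis
    using assms by simp
qed

lemma sets_generated:
  "sets (generated I) = {(\<lambda>\<omega>. restrict (\<lambda>n. a n \<omega>) I) -` A \<inter> space M |A. A \<in> sets (PiM I (\<lambda>_. borel))}"
  unfolding generated_def by (rule sets_vimage_algebra2) (auto simp: space_PiM)

lemma sets_generated_subset: "E \<in> sets (generated I) \<Longrightarrow> E \<in> sets M"
  unfolding sets_generated by (auto intro!: measurable_sets measurable_restrict)

text \<open>The blocks of coefficients over \<open>I\<close> and over \<open>{n}\<close> are
  independent. Applied with \<open>I\<close> the past of the walk and the tails, and
  \<open>n\<close> the index of the next step.\<close>

lemma prob_generated_Int: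
  assumes E: "E \<in> sets (generated I)" and n: "n \<notin> I" and B: "B \<in> sets borel"
  shows "prob (E \<inter> {\<omega> \<in> space M. a n \<omega> \<in> B}) = prob E * prob {\<omega> \<in> space M. a n \<omega> \<in> B}"
proof -
  obtain A where A: "A \<in> sets (PiM I (\<lambda>_. borel))" "E = (\<lambda>\<omega>. restrict (\<lambda>n. a n \<omega>) I) -` A \<inter> space M"
    using E unfolding sets_generated by auto
  let ?B = "(\<lambda>g. g n) -` B \<inter> space (PiM {n} (\<lambda>_. borel :: real measure))"
  have B': "?B \<in> sets (PiM {n} (\<lambda>_. borel))"
    by (rule measurable_sets[OF measurable_component_singleton[of n "{n}" "\<lambda>_. borel"] B]) simp
  have eq: "(\<lambda>\<omega>. restrict (\<lambda>n. a n \<omega>) {n}) -` ?B \<inter> space M = {\<omega> \<in> space M. a n \<omega> \<in> B}"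
    by (auto simp: space_PiM)
  have "prob ((\<lambda>\<omega>. (restrict (\<lambda>n. a n \<omega>) I, restrict (\<lambda>n. a n \<omega>) {n})) -` (A \<times> ?B) \<inter> space M) =
      prob E * prob {\<omega> \<in> space M. a n \<omega> \<in> B}"
    using indep_varD[OF indep_var_restrict[OF indep, of I "{n}"] A(1) B'] n A(2) eq by auto
  also have "(\<lambda>\<omega>. (restrict (\<lambda>n. a n \<omega>) I, restrict (\<lambda>n. a n \<omega>) {n})) -` (A \<times> ?B) \<inter> space M =
      E \<inter> {\<omega> \<in> space M. a n \<omega> \<in> B}"
    unfolding A(2) eq[symmetric] by auto
  finally show ?thesis .
qed

text \<open>The density decreases on the positive half-line, and 31 is the far end of the windows
  [29, 30] and [30, 31] used for the steps.\<close>

lemma prob_unit_interval: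
  assumes "0 \<le> t" "t + 1 \<le> 31"
  shows "std_normal_density 31 \<le> prob {\<omega> \<in> space M. a n \<omega> \<in> {t..t + 1}}"
proof -
  have "ennreal (std_normal_density 31) = (\<integral>\<^sup>+x. ennreal (std_normal_density 31) * indicator {t..t + 1} x \<partial>lborel)"
    by (simp add: nn_integral_cmult_indicator)
  also have "\<dots> \<le> (\<integral>\<^sup>+x. ennreal (std_normal_density x) * indicator {t..t + 1} x \<partial>lborel)"
  proof (intro nn_integral_mono)
    fix x :: real
    have "std_normal_density 31 \<le> std_normal_density x" if "x \<in> {t..t + 1}"
    proof -
      have "x\<^sup>2 \<le> 31\<^sup>2" using that assms by (intro power_mono) auto
      then show ?thesis unfolding std_normal_density_def by (intro mult_left_mono) auto
    qed
    then show "ennreal (std_normal_density 31) * indicator {t..t + 1} x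
        \<le> ennreal (std_normal_density x) * indicator {t..t + 1} x"
      by (auto split: split_indicator intro: ennreal_leI)
  qed
  also have "\<dots> = emeasure M (a n -` {t..t + 1} \<inter> space M)"
    by (rule distributed_emeasure[OF dist, symmetric]) simp
  also have "a n -` {t..t + 1} \<inter> space M = {\<omega> \<in> space M. a n \<omega> \<in> {t..t + 1}}" by auto
  finally show ?thesis by (simp add: emeasure_eq_measure)
qed

section \<open>Tails and walk as one event\<close>

definition tail_event :: "nat \<Rightarrow> real \<Rightarrow> 'a \<Rightarrow> bool" where
  "tail_event K R \<omega> \<longleftrightarrow>
     \<bar>signed_tail K (pos_half (\<lambda>n. a n \<omega>))\<bar> \<le> 1 \<and> R * abs_tail K (pos_half (\<lambda>n. a n \<omega>)) \<le> 1 \<and>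
     \<bar>signed_tail K (neg_half (\<lambda>n. a n \<omega>))\<bar> \<le> 1 \<and> R * abs_tail K (neg_half (\<lambda>n. a n \<omega>)) \<le> 1"

definition walk :: "nat \<Rightarrow> nat \<Rightarrow> 'a \<Rightarrow> real" where
  "walk K i \<omega> = (\<Sum>j<i. (- 1) ^ j * (a (int j - int K) \<omega> - 30))"

text \<open>The tail condition is built in from time 0, so the independence of tails and walk is
  used step by step within one induction on \<open>i\<close>.\<close>

definition walk_event :: "nat \<Rightarrow> real \<Rightarrow> nat \<Rightarrow> 'a set" where
  "walk_event K R i = {\<omega> \<in> space M. tail_event K R \<omega> \<and> (\<forall>j\<in>{..i}. \<bar>walk K j \<omega>\<bar> \<le> 1)}"

text \<open>The indices that \<open>walk_event K R i\<close> depends on: those below -K and from K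
  on for the tails, and -K, ..., i - K - 1 for the first i steps. While i < 2K, the next index i - K
  is not among them.\<close>

definition used :: "nat \<Rightarrow> nat \<Rightarrow> int set" where
  "used K i = {n. n < int i - int K \<or> int K \<le> n}"

lemma measurable_walk: "j \<le> i \<Longrightarrow> walk K j \<in> borel_measurable (generated (used K i))"
  unfolding walk_def
  by (intro borel_measurable_sum borel_measurable_times borel_measurable_diff borel_measurable_const
      measurable_generated) (auto simp: used_def)

lemma walk_event_generated: "walk_event K R i \<in> sets (generated (used K i))"
proof -
  let ?G = "generated (used K i)"
  have [measurable]: "(\<lambda>\<omega>. pos_half (\<lambda>n. a n \<omega>) (k + K)) \<in> borel_measurable ?G" for k
    unfolding pos_half_def by (rule measurable_generated) (simp add: used_def)
  have [measurable]: "(\<lambda>\<omega>. neg_half (\<lambda>n. a n \<omega>) (k + K)) \<in> borel_measurable ?G" for k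
    unfolding neg_half_def by (rule measurable_generated) (simp add: used_def)
  have [measurable]: "Measurable.pred ?G (tail_event K R)"
    unfolding tail_event_def signed_tail_def abs_tail_def by measurable
  have "Measurable.pred ?G (\<lambda>\<omega>. \<forall>j\<in>{..i}. \<bar>walk K j \<omega>\<bar> \<le> 1)"
  proof (intro pred_intros_finite)
    fix j assume "j \<in> {..i}"
    then have [measurable]: "walk K j \<in> borel_measurable ?G" by (intro measurable_walk) simp
    show "Measurable.pred ?G (\<lambda>\<omega>. \<bar>walk K j \<omega>\<bar> \<le> 1)" by measurable
  qed simp
  then have "{\<omega> \<in> space ?G. tail_event K R \<omega> \<and> (\<forall>j\<in>{..i}. \<bar>walk K j \<omega>\<bar> \<le> 1)} \<in> sets ?G"
    by measurable
  then show ?thesis by (simp add: walk_event_def)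
qed

text \<open>Whatever the sign of the current position, one of two unit intervals of steps towards the
  origin keeps the walk in \<open>[-1, 1]\<close>.\<close>

lemma walk_event_step:
  assumes "i < 2 * K"
  shows "std_normal_density 31 * prob (walk_event K R i) \<le> prob (walk_event K R (Suc i))"
proof -
  let ?E = "walk_event K R i" and ?n = "int i - int K" and ?G = "generated (used K i)"
  let ?p = "std_normal_density 31"
  define P where "P = ?E \<inter> {\<omega> \<in> space M. 0 \<le> walk K i \<omega>}"
  define N where "N = ?E \<inter> {\<omega> \<in> space M. walk K i \<omega> < 0}"
  define lo hi :: "real set" where "lo = {29..30}" and "hi = {30..31}"
  define B where "B = (\<lambda>S. {\<omega> \<in> space M. a ?n \<omega> \<in> S})"
  have n: "?n \<notin> used K i" using assms by (auto simp: used_def)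
  have [measurable]: "walk K i \<in> borel_measurable ?G" by (intro measurable_walk) simp
  have "{\<omega> \<in> space ?G. 0 \<le> walk K i \<omega>} \<in> sets ?G" "{\<omega> \<in> space ?G. walk K i \<omega> < 0} \<in> sets ?G"
    by measurable
  then have PG: "P \<in> sets ?G" and NG: "N \<in> sets ?G"
    using walk_event_generated[of K R i] by (auto simp: P_def N_def)
  have EPN: "?E = P \<union> N" "P \<inter> N = {}"
    by (auto simp: P_def N_def walk_event_def)
  have PN [measurable]: "P \<in> sets M" "N \<in> sets M"
    using PG NG by (auto intro: sets_generated_subset)
  have BM: "B lo \<in> sets M" "B hi \<in> sets M" unfolding B_def lo_def hi_def by measurable
  have p: "?p \<le> prob (B lo)" "?p \<le> prob (B hi)"
    using prob_unit_interval[of 29 ?n] prob_unit_interval[of 30 ?n] by (auto simp: B_def lo_def hi_def)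
  have step: "prob F * ?p \<le> prob (F \<inter> B S)" if "F \<in> sets ?G" "S = lo \<or> S = hi" for F S
  proof -
    have "prob (F \<inter> B S) = prob F * prob (B S)"
      unfolding B_def using that by (intro prob_generated_Int[OF _ n]) (auto simp: lo_def hi_def)
    then show ?thesis using that p by (auto intro: mult_left_mono)
  qed
  \<comment> \<open>The step is (-1)^i (a - 30), so parity decides which window moves the walk down.
    \<open>S1\<close> is that window, taken from a nonnegative position; \<open>S2\<close> moves it
    up from a negative one.\<close>
  define S1 S2 where "S1 = (if even i then lo else hi)" and "S2 = (if even i then hi else lo)"
  have sub: "(P \<inter> B S1) \<union> (N \<inter> B S2) \<subseteq> walk_event K R (Suc i)"
  proof
    fix \<omega> assume \<omega>: "\<omega> \<in> (P \<inter> B S1) \<union> (N \<inter> B S2)"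
    then have E: "\<omega> \<in> ?E" by (auto simp: P_def N_def)
    have "walk K (Suc i) \<omega> = walk K i \<omega> + (- 1) ^ i * (a ?n \<omega> - 30)" by (simp add: walk_def)
    moreover have "\<bar>walk K i \<omega>\<bar> \<le> 1" using E by (auto simp: walk_event_def)
    ultimately have "\<bar>walk K (Suc i) \<omega>\<bar> \<le> 1"
      using \<omega> by (cases "even i") (auto simp: P_def N_def B_def S1_def S2_def lo_def hi_def abs_le_iff)
    then show "\<omega> \<in> walk_event K R (Suc i)"
      using E by (auto simp: walk_event_def atMost_Suc)
  qed
  have "?p * prob ?E = prob P * ?p + prob N * ?p"
    using finite_measure_Union[OF PN EPN(2)] EPN(1) by (simp add: algebra_simps)
  also have "\<dots> \<le> prob (P \<inter> B S1) + prob (N \<inter> B S2)"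
    using PG NG by (intro add_mono step) (auto simp: S1_def S2_def)
  also have "\<dots> = prob ((P \<inter> B S1) \<union> (N \<inter> B S2))"
    using PN BM EPN(2) by (intro finite_measure_Union[symmetric]) (auto simp: S1_def S2_def)
  also have "\<dots> \<le> prob (walk_event K R (Suc i))"
    by (intro finite_measure_mono sub sets_generated_subset[OF walk_event_generated])
  finally show ?thesis .
qed

text \<open>At time 0 the walk is the empty sum, so only the tails count. The union bound over four
  bad events gives 2 (1 + R) / K, which is where 4 (R + 1) \<le> K comes from.\<close>

lemma prob_walk_event_0:
  assumes K: "0 < K" "4 * (R + 1) \<le> real K" and R: "0 \<le> R"
  shows "1 / 2 \<le> prob (walk_event K R 0)"
proof -
  define X where "X = (\<lambda>\<phi> :: nat \<Rightarrow> int. {\<omega> \<in> space M. \<not> \<bar>signed_tail K (\<lambda>k. a (\<phi> k) \<omega>)\<bar> \<le> 1})"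
  define Y where "Y = (\<lambda>\<phi> :: nat \<Rightarrow> int. {\<omega> \<in> space M. \<not> R * abs_tail K (\<lambda>k. a (\<phi> k) \<omega>) \<le> 1})"
  let ?f = "\<lambda>k. int k" and ?g = "\<lambda>k. - int (Suc k)"
  have [measurable]: "X \<phi> \<in> sets M" "Y \<phi> \<in> sets M" for \<phi>
    unfolding X_def Y_def signed_tail_def abs_tail_def by measurable
  have XY: "prob (X \<phi>) \<le> 1 / real K" "prob (Y \<phi>) \<le> R / real K" if "inj \<phi>" for \<phi>
    unfolding X_def Y_def using prob_signed_tail[OF that] prob_abs_tail[OF that] K R by auto
  have "walk_event K R 0 = space M - (X ?f \<union> Y ?f \<union> (X ?g \<union> Y ?g))"
    unfolding walk_event_def X_def Y_def tail_event_def walk_def pos_half_def[abs_def] neg_half_def[abs_def]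
    by auto
  then have "prob (walk_event K R 0) = 1 - prob (X ?f \<union> Y ?f \<union> (X ?g \<union> Y ?g))"
    by (simp only:) (rule prob_compl, measurable)
  moreover have "prob (X ?f \<union> Y ?f \<union> (X ?g \<union> Y ?g)) \<le>
      (prob (X ?f) + prob (Y ?f)) + (prob (X ?g) + prob (Y ?g))"
    by (intro order_trans[OF measure_Un_le] add_mono measure_Un_le) measurable
  moreover have "2 * ((1 + R) / real K) \<le> 1 / 2"
    using K by (simp add: divide_simps)
  ultimately show ?thesis
    using XY[OF inj_halves(1)] XY[OF inj_halves(2)] by (simp add: add_divide_distrib)
qed

lemma prob_walk_event:
  assumes K: "0 < K" "4 * (R + 1) \<le> real K" and R: "0 \<le> R" and i: "i \<le> 2 * K"
  shows "std_normal_density 31 ^ i / 2 \<le> prob (walk_event K R i)"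
  using i
proof (induction i)
  case 0
  then show ?case using prob_walk_event_0[OF K R] by simp
next
  case (Suc i)
  have "std_normal_density 31 * (std_normal_density 31 ^ i / 2) \<le>
      std_normal_density 31 * prob (walk_event K R i)"
    using Suc by (intro mult_left_mono) auto
  also have "\<dots> \<le> prob (walk_event K R (Suc i))"
    using Suc.prems by (intro walk_event_step) simp
  finally show ?case by simp
qed

section \<open>The hole event\<close>

lemma measurable_real_series [measurable]: "(\<lambda>\<omega>. real_series (\<lambda>n. a n \<omega>) x) \<in> borel_measurable M"
  unfolding real_series_def half_series_def pos_half_def neg_half_def by measurable

lemma hole_event_iff:
  assumes "\<omega> \<in> space M" "convergent_coeffs (\<lambda>n. a n \<omega>)"
  shows "\<omega> \<in> hole_event M a r \<longleftrightarrow> \<not> (\<exists>x\<in>{-r<..<r}. real_series (\<lambda>n. a n \<omega>) x = 0)"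
proof -
  have "zero_set f \<inter> of_real ` S = {} \<longleftrightarrow> \<not> (\<exists>x\<in>S. f (of_real x) = 0)" for f and S :: "real set"
    by (auto simp: zero_set_def)
  then show ?thesis
    using assms(1) by (simp add: hole_event_def sinc_series_of_real[OF assms(2)])
qed

lemma exceptional_null_set:
  "\<exists>N\<in>null_sets M. \<forall>\<omega>\<in>space M. \<omega> \<notin> N \<longrightarrow> convergent_coeffs (\<lambda>n. a n \<omega>)"
  using AE_convergent unfolding eventually_ae_filter by blast

text \<open>Off a null set the event agrees with \<open>H\<close>, a countable combination of
  conditions at rational points; what it does inside the null set is absorbed by the
  completion.\<close>

lemma sets_hole_event: "hole_event M a r \<in> sets (completion M)"
proof -
  obtain N where N: "N \<in> null_sets M"
    "\<And>\<omega>. \<omega> \<in> space M \<Longrightarrow> \<omega> \<notin> N \<Longrightarrow> convergent_coeffs (\<lambda>n. a n \<omega>)"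
    using exceptional_null_set by blast
  define H where "H = {\<omega> \<in> space M. \<not> (\<exists>m::nat. \<forall>k::nat. \<exists>q::rat.
      \<bar>real_of_rat q\<bar> \<le> r - 1 / real (Suc m) \<and>
      \<bar>real_series (\<lambda>n. a n \<omega>) (real_of_rat q)\<bar> < 1 / real (Suc k))}"
  have H: "H \<in> sets M" unfolding H_def by measurable
  have "\<omega> \<in> hole_event M a r \<longleftrightarrow> \<omega> \<in> H" if "\<omega> \<in> space M" "\<omega> \<notin> N" for \<omega>
    unfolding hole_event_iff[OF that(1) N(2)[OF that]]
      zero_in_interval_iff_rat[OF continuous_on_real_series[OF N(2)[OF that]]] H_def
    using that by simp
  moreover have "hole_event M a r \<subseteq> space M" "H \<subseteq> space M" by (auto simp: hole_event_def H_def)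
  ultimately have "hole_event M a r = (H - N) \<union> (hole_event M a r \<inter> N)" by blast
  then show ?thesis
    using H N(1) by (intro sets_completionI[of _ "H - N" "hole_event M a r \<inter> N" N M]) auto
qed

lemma measure_completion_minus_null:
  assumes "E \<in> sets M" "N \<in> null_sets M"
  shows "measure (completion M) (E - N) = prob E" "measure (completion M) (E \<union> N) = prob E"
proof -
  have "E - N \<in> sets M" "E \<union> N \<in> sets M" using assms by auto
  then show "measure (completion M) (E - N) = prob E" "measure (completion M) (E \<union> N) = prob E"
    using assms by (simp_all only: measure_completion measure_Diff_null_set measure_Un_null_set)
qed

lemma hole_prob_ge:
  assumes E: "E \<in> sets M"
    and sub: "\<And>\<omega>. \<omega> \<in> E \<Longrightarrow> convergent_coeffs (\<lambda>n. a n \<omega>) \<Longrightarrow> \<omega> \<in> hole_event M a r"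
  shows "prob E \<le> hole_prob M a r"
proof -
  interpret c: prob_space "completion M" by (rule prob_space_completion)
  obtain N where N: "N \<in> null_sets M"
    "\<And>\<omega>. \<omega> \<in> space M \<Longrightarrow> \<omega> \<notin> N \<Longrightarrow> convergent_coeffs (\<lambda>n. a n \<omega>)"
    using exceptional_null_set by blast
  have "E - N \<subseteq> hole_event M a r"
    using sub N(2) sets.sets_into_space[OF E] by blast
  then have "measure (completion M) (E - N) \<le> hole_prob M a r"
    unfolding hole_prob_def by (intro c.finite_measure_mono sets_hole_event)
  then show ?thesis using measure_completion_minus_null[OF E N(1)] by simp
qed

lemma hole_prob_le:
  assumes E: "E \<in> sets M"
    and sub: "\<And>\<omega>. \<omega> \<in> hole_event M a r \<Longrightarrow> convergent_coeffs (\<lambda>n. a n \<omega>) \<Longrightarrow> \<omega> \<in> E"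
  shows "hole_prob M a r \<le> prob E"
proof -
  interpret c: prob_space "completion M" by (rule prob_space_completion)
  obtain N where N: "N \<in> null_sets M"
    "\<And>\<omega>. \<omega> \<in> space M \<Longrightarrow> \<omega> \<notin> N \<Longrightarrow> convergent_coeffs (\<lambda>n. a n \<omega>)"
    using exceptional_null_set by blast
  have "hole_event M a r \<subseteq> E \<union> N"
    using sub N(2) by (auto simp: hole_event_def)
  then have "hole_prob M a r \<le> measure (completion M) (E \<union> N)"
    unfolding hole_prob_def using E N(1) by (intro c.finite_measure_mono) auto
  then show ?thesis using measure_completion_minus_null[OF E N(1)] by simp
qed

section \<open>Upper bound: signs of the coefficients\<close>

lemma prob_half_line:
  shows "prob (a n -` {0..} \<inter> space M) = 1 / 2" "prob (a n -` {..0} \<inter> space M) = 1 / 2"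
proof -
  have "distributed M lborel (\<lambda>\<omega>. - a n \<omega>) std_normal_density"
    using normal_density_affine[OF dist[of n], of "- 1" 0] by simp
  from distributed_emeasure[OF this, of "{0..}"] distributed_emeasure[OF dist[of n], of "{0..}"]
  have "prob (a n -` {0..} \<inter> space M) = prob ((\<lambda>\<omega>. - a n \<omega>) -` {0..} \<inter> space M)"
    by (simp add: measure_def)
  also have "(\<lambda>\<omega>. - a n \<omega>) -` {0..} \<inter> space M = a n -` {..0} \<inter> space M" by auto
  finally have eq: "prob (a n -` {0..} \<inter> space M) = prob (a n -` {..0} \<inter> space M)" .
  \<comment> \<open>By symmetry the two closed half-lines have equal probability; as they overlap
    only in a null event, each has probability 1/2.\<close>
  have "emeasure M (a n -` {0} \<inter> space M) = (\<integral>\<^sup>+x. ennreal (std_normal_density x) * indicator {0} x \<partial>lborel)"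
    by (rule distributed_emeasure[OF dist]) simp
  also have "\<dots> = (\<integral>\<^sup>+(x::real). 0 \<partial>lborel)"
    by (intro nn_integral_cong_AE) (use AE_lborel_singleton[of "0::real"] in \<open>auto elim!: eventually_mono\<close>)
  finally have z: "prob (a n -` {0} \<inter> space M) = 0"
    by (simp add: emeasure_eq_measure)
  have U: "space M = (a n -` {0..} \<inter> space M) \<union> (a n -` {..0} \<inter> space M)" by auto
  have I: "(a n -` {0..} \<inter> space M) \<inter> (a n -` {..0} \<inter> space M) = a n -` {0} \<inter> space M" by auto
  have "prob ((a n -` {0..} \<inter> space M) \<union> (a n -` {..0} \<inter> space M)) =
      prob (a n -` {0..} \<inter> space M) + prob (a n -` {..0} \<inter> space M) -
      prob ((a n -` {0..} \<inter> space M) \<inter> (a n -` {..0} \<inter> space M))"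
    by (intro measure_Un3) (auto simp: fmeasurable_eq_sets)
  then have "1 = prob (a n -` {0..} \<inter> space M) + prob (a n -` {..0} \<inter> space M)"
    unfolding U[symmetric] I z prob_space by simp
  with eq show "prob (a n -` {0..} \<inter> space M) = 1 / 2" "prob (a n -` {..0} \<inter> space M) = 1 / 2"
    by auto
qed

text \<open>The endpoints |n| = r are included although the interval is open: if \<open>a n\<close>
  had the sign strictly opposite to f(0), the intermediate value theorem would give a zero strictly
  between 0 and n, hence inside (-r, r). The factor s = 1 or -1 treats both signs of f(0)
  together.\<close>

lemma hole_coefficients_sign:
  assumes conv: "convergent_coeffs (\<lambda>n. a n \<omega>)" and hole: "\<omega> \<in> hole_event M a r" and r: "0 < r"
  shows "(\<forall>n. \<bar>real_of_int n\<bar> \<le> r \<longrightarrow> 0 \<le> a n \<omega>) \<or> (\<forall>n. \<bar>real_of_int n\<bar> \<le> r \<longrightarrow> a n \<omega> \<le> 0)"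
proof -
  let ?F = "real_series (\<lambda>n. a n \<omega>)"
  have nz: "?F x \<noteq> 0" if "\<bar>x\<bar> < r" for x
  proof -
    have "x \<in> {-r<..<r}" using that by auto
    then show ?thesis using hole_event_iff[OF _ conv, of r] hole by (auto simp: hole_event_def)
  qed
  have cont: "continuous_on S ?F" for S by (rule continuous_on_real_series[OF conv])
  have same: "0 \<le> s * ?F y" if s: "s = 1 \<or> s = -1" and F0: "0 < s * ?F 0" and y: "\<bar>y\<bar> \<le> r" for s y
  proof (rule ccontr)
    assume neg: "\<not> 0 \<le> s * ?F y"
    have "\<exists>x. x \<in> closed_segment 0 y \<and> s * ?F x = 0"
    proof (cases "0 \<le> y")
      case True
      then have "\<exists>x\<ge>0. x \<le> y \<and> s * ?F x = 0"
        using neg F0 by (intro IVT2' continuous_intros cont) auto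
      then show ?thesis using True by (auto simp: closed_segment_eq_real_ivl)
    next
      case False
      then have "\<exists>x\<ge>y. x \<le> 0 \<and> s * ?F x = 0"
        using neg F0 by (intro IVT' continuous_intros cont) auto
      then show ?thesis using False by (auto simp: closed_segment_eq_real_ivl)
    qed
    then obtain x where x: "x \<in> closed_segment 0 y" "?F x = 0" using s by auto
    have "x \<noteq> y" using x(2) neg by auto
    then have "\<bar>x\<bar> < \<bar>y\<bar>"
      using x(1) by (auto simp: closed_segment_eq_real_ivl split: if_splits)
    then show False using nz[of x] x(2) y by simp
  qed
  have "?F 0 \<noteq> 0" using r by (intro nz) simp
  then consider "0 < ?F 0" | "?F 0 < 0" by linarith
  then show ?thesis
  proof cases
    case 1
    then show ?thesis using same[of 1] real_series_int[of "\<lambda>n. a n \<omega>"] by force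
  next
    case 2
    then show ?thesis using same[of "- 1"] real_series_int[of "\<lambda>n. a n \<omega>"] by force
  qed
qed

lemma hole_prob_upper:
  assumes r: "1 \<le> r"
  shows "hole_prob M a r \<le> exp (- ln 2 * r)"
proof -
  define m where "m = nat \<lfloor>r\<rfloor>"
  have m: "1 \<le> m" "real m \<le> r" "r < real m + 1"
    using r unfolding m_def by linarith+
  define J where "J = {- int m..int m}"
  have J: "finite J" "J \<noteq> {}" "card J = 2 * m + 1" by (auto simp: J_def)
  let ?P = "\<Inter>n\<in>J. a n -` {0..} \<inter> space M" and ?N = "\<Inter>n\<in>J. a n -` {..0} \<inter> space M"
  have P: "prob ?P = (1 / 2) ^ (2 * m + 1)"
    using indep_varsD[OF indep J(2,1), of "\<lambda>_. {0..}"] by (simp add: prob_half_line J(3))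
  have N: "prob ?N = (1 / 2) ^ (2 * m + 1)"
    using indep_varsD[OF indep J(2,1), of "\<lambda>_. {..0}"] by (simp add: prob_half_line J(3))
  have PN: "?P \<in> sets M" "?N \<in> sets M"
    using J by (auto intro!: sets.finite_INT)
  have "hole_prob M a r \<le> prob (?P \<union> ?N)"
  proof (rule hole_prob_le)
    fix \<omega> assume \<omega>: "\<omega> \<in> hole_event M a r" "convergent_coeffs (\<lambda>n. a n \<omega>)"
    have "\<bar>real_of_int n\<bar> \<le> r" if "n \<in> J" for n
      using that m by (auto simp: J_def abs_le_iff)
    moreover have "\<omega> \<in> space M" using \<omega> by (simp add: hole_event_def)
    ultimately show "\<omega> \<in> ?P \<union> ?N"
      using hole_coefficients_sign[OF \<omega>(2,1)] r by auto
  qed (use PN in auto)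
  also have "\<dots> \<le> prob ?P + prob ?N" by (rule measure_Un_le[OF PN])
  also have "\<dots> = (1 / 4) ^ m"
    unfolding P N by (simp add: power_mult power2_eq_square)
  also have "\<dots> = exp (- ln 2 * (2 * real m))"
  proof -
    have "exp (- ln 2 * (2 * real m)) = exp (real m * ln (1 / 4))"
      using ln_realpow[of 2 2] by (simp add: ln_div)
    also have "\<dots> = (1 / 4) ^ m" by (simp add: exp_of_nat_mult)
    finally show ?thesis ..
  qed
  \<comment> \<open>Since m \<ge> 1, r < m + 1 \<le> 2 m.\<close>
  also have "\<dots> \<le> exp (- ln 2 * r)"
    using m by (simp add: mult_le_cancel_left)
  finally show ?thesis .
qed

section \<open>Lower bound: choice of the parameters\<close>

lemma hole_prob_lower:
  assumes r: "1 \<le> r"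
  shows "exp (- (34 * \<bar>ln (std_normal_density 31)\<bar> + ln 2) * r) \<le> hole_prob M a r"
proof -
  \<comment> \<open>With R = r + 2 this is the requirement 4 (R + 1) \<le> K; it also gives 2 R
    \<le> K, as \<open>real_series_pos\<close> demands.\<close>
  define K where "K = nat \<lceil>4 * (r + 3)\<rceil>"
  have K: "4 * (r + 3) \<le> real K" "real K \<le> 4 * (r + 3) + 1" "0 < K"
  proof -
    have "0 < 4 * (r + 3)" using r by (intro mult_pos_pos add_pos_pos) auto
    then have "0 < \<lceil>4 * (r + 3)\<rceil>" by (simp only: zero_less_ceiling)
    then show "4 * (r + 3) \<le> real K" "real K \<le> 4 * (r + 3) + 1" "0 < K"
      unfolding K_def by (simp_all, linarith)
  qed
  let ?p = "std_normal_density 31" and ?E = "walk_event K (r + 2) (2 * K)"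
  have p: "0 < ?p" by (simp add: std_normal_density_def)
  \<comment> \<open>The 34 arises from 2 K \<le> 8 r + 26 \<le> 34 r for r \<ge> 1, and ln 2 pays
    for the factor 1/2 of the tails. The absolute value makes the constant positive without
    evaluating the density.\<close>
  have "(34 * \<bar>ln ?p\<bar> + ln 2) * r \<ge> 2 * real K * \<bar>ln ?p\<bar> + ln 2"
  proof -
    have "2 * real K * \<bar>ln ?p\<bar> \<le> (34 * r) * \<bar>ln ?p\<bar>"
      using K r by (intro mult_right_mono) auto
    moreover have "ln 2 * 1 \<le> ln 2 * r" using r by (intro mult_left_mono) auto
    moreover have "(34 * \<bar>ln ?p\<bar> + ln 2) * r = (34 * r) * \<bar>ln ?p\<bar> + ln 2 * r"
      by (simp add: algebra_simps)
    ultimately show ?thesis by linarith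
  qed
  moreover have "- (2 * real K * \<bar>ln ?p\<bar>) \<le> real (2 * K) * ln ?p"
    using mult_left_mono[of "- \<bar>ln ?p\<bar>" "ln ?p" "2 * real K"] by simp
  ultimately have "- (34 * \<bar>ln ?p\<bar> + ln 2) * r \<le> real (2 * K) * ln ?p - ln 2"
    by linarith
  then have "exp (- (34 * \<bar>ln ?p\<bar> + ln 2) * r) \<le> exp (real (2 * K) * ln ?p - ln 2)"
    by simp
  also have "\<dots> = ?p ^ (2 * K) / 2"
    using p unfolding exp_diff exp_of_nat_mult by simp
  also have "\<dots> \<le> prob ?E"
    using K r by (intro prob_walk_event) auto
  also have "\<dots> \<le> hole_prob M a r"
  proof (rule hole_prob_ge)
    show "?E \<in> sets M" by (rule sets_generated_subset[OF walk_event_generated])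
    fix \<omega> assume \<omega>: "\<omega> \<in> ?E" and conv: "convergent_coeffs (\<lambda>n. a n \<omega>)"
    have "0 < real_series (\<lambda>n. a n \<omega>) x" if "x \<in> {-r<..<r}" for x
      using \<omega> that K
      by (intro real_series_pos[OF conv, of x "r + 2" K]) (auto simp: walk_event_def tail_event_def walk_def)
    then show "\<omega> \<in> hole_event M a r"
      using \<omega> hole_event_iff[OF _ conv] by (force simp: walk_event_def)
  qed
  finally show ?thesis .
qed

end

theorem theorem1:
  fixes M :: "'a measure" and a :: "int \<Rightarrow> 'a \<Rightarrow> real"
  assumes "prob_space M"
    and "prob_space.indep_vars M (\<lambda>_. borel) a UNIV"
    and "\<And>n. distributed M lborel (a n) std_normal_density"
  shows "\<exists>c C :: real. c > 0 \<and> C > 0 \<and>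
    (\<forall>r :: real. r \<ge> 1 \<longrightarrow>
      exp (- c * r) \<le> hole_prob M a r \<and> hole_prob M a r \<le> exp (- C * r))"
proof -
  interpret iid_gaussian M a
    using assms by (simp add: iid_gaussian_def iid_gaussian_axioms_def)
  have "0 < 34 * \<bar>ln (std_normal_density 31)\<bar> + ln 2"
    by (intro add_nonneg_pos) auto
  moreover have "0 < ln (2 :: real)" by simp
  ultimately show ?thesis
    using hole_prob_lower hole_prob_upper by blast
qed

end
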